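(* Let $m,n$ be fixed nonzero integers with $m+n\neq0$, let $H$ be a separable complex Hilbert space, and let $\mathcal{L}$ be a commutative subspace lattice (CSL) on $H$. If $\delta:\mathrm{alg}\mathcal{L}\to\mathrm{alg}\mathcal{L}$ is a norm-continuous linear $(m,n)$-derivable mapping at $0$ with $\delta(I)=0$, then $\delta$ is a derivation.
   Context: A subspace lattice on $H$ is a collection $\mathcal{L}$ of closed subspaces of $H$ containing $(0)$ and $H$ and closed under arbitrary intersections and closed linear spans; closed subspaces are identified with the orthogonal projections onto them. $\mathcal{L}$ is a commutative subspace lattice (CSL) if all projections in $\mathcal{L}$ commute pairwise. $\mathrm{alg}\mathcal{L}$ is the algebra of all bounded linear operators on $H$ leaving every member of $\mathcal{L}$ invariant. For a unital algebra $\mathcal{A}$, a linear map $\delta:\mathcal{A}\to\mathcal{A}$ is $(m,n)$-derivable at $0$ if $m\delta(AB)+n\delta(BA)=m\delta(A)B+mA\delta(B)+n\delta(B)A+nB\delta(A)$ for all $A,B\in\mathcal{A}$ with $AB=0$. It is a derivation if $\delta(AB)=\delta(A)B+A\delta(B)$ for all $A,B\in\mathcal{A}$. *)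

theory Defs
  imports "HOL-Analysis.Analysis"
begin

class complex_vector = real_vector +
  fixes scaleC :: "complex \<Rightarrow> 'a \<Rightarrow> 'a" (infixr \<open>*\<^sub>C\<close> 75)
  assumes scaleC_add_right: "c *\<^sub>C (x + y) = c *\<^sub>C x + c *\<^sub>C y"
    and scaleC_add_left: "(c + d) *\<^sub>C x = c *\<^sub>C x + d *\<^sub>C x"
    and scaleC_scaleC: "c *\<^sub>C d *\<^sub>C x = (c * d) *\<^sub>C x"
    and scaleC_one: "1 *\<^sub>C x = x"
    and scaleR_scaleC: "r *\<^sub>R x = of_real r *\<^sub>C x"

global_interpretation complex_vector: vector_space "scaleC :: complex \<Rightarrow> 'a \<Rightarrow> 'a::complex_vector"
  defines csubspace = complex_vector.subspace
    and cspan = complex_vector.span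
  by standard (simp_all add: scaleC_add_right scaleC_add_left scaleC_scaleC scaleC_one)

text \<open>
  The complex inner product is linear in its first argument. Its real part is the real inner
  product of \<^class>\<open>real_inner\<close>, so positive definiteness and
  the identity between the norm and the square root of the inner product are inherited from there,
  and the topology is the one of the norm.
\<close>

class complex_hilbert = complex_vector + real_inner + complete_space +
  fixes cinner :: "'a \<Rightarrow> 'a \<Rightarrow> complex"
  assumes cinner_commute: "cinner x y = cnj (cinner y x)"
    and cinner_add_left: "cinner (x + y) z = cinner x z + cinner y z"
    and cinner_scaleC_left: "cinner (c *\<^sub>C x) y = c * cinner x y"
    and inner_eq_Re_cinner: "inner x y = Re (cinner x y)"

instantiation complex :: complex_hilbert
begin
definition scaleC_complex :: "complex \<Rightarrow> complex \<Rightarrow> complex" where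
  "scaleC_complex c x = c * x"
definition cinner_complex :: "complex \<Rightarrow> complex \<Rightarrow> complex" where
  "cinner_complex x y = x * cnj y"
instance
  by standard
    (simp_all add: scaleC_complex_def cinner_complex_def algebra_simps scaleR_conv_of_real inner_complex_def)
end

lemma cinner_self: "cinner x x = of_real ((norm (x :: 'a::complex_hilbert))\<^sup>2)"
proof -
  have "Im (cinner x x) = 0"
    using cinner_commute[of x x] by (metis Reals_cnj_iff complex_is_Real_iff)
  moreover have "Re (cinner x x) = (norm x)\<^sup>2"
    by (simp add: inner_eq_Re_cinner[symmetric] power2_norm_eq_inner)
  ultimately show ?thesis by (simp add: complex_eq_iff)
qed

lemma cinner_scaleC_right: "cinner x (c *\<^sub>C y) = cnj c * cinner (x :: 'a::complex_hilbert) y"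
  by (metis cinner_commute cinner_scaleC_left complex_cnj_cnj complex_cnj_mult)

lemma norm_scaleC: "norm (c *\<^sub>C x) = cmod c * norm (x :: 'a::complex_hilbert)"
proof -
  have "complex_of_real ((norm (c *\<^sub>C x))\<^sup>2) = c * cnj c * cinner x x"
    by (simp only: cinner_self[symmetric] cinner_scaleC_left cinner_scaleC_right mult_ac)
  also have "\<dots> = of_real ((cmod c * norm x)\<^sup>2)"
    by (simp add: complex_norm_square[symmetric] cinner_self power_mult_distrib)
  finally have "(norm (c *\<^sub>C x))\<^sup>2 = (cmod c * norm x)\<^sup>2"
    using of_real_eq_iff by blast
  then show ?thesis by (simp add: power2_eq_iff_nonneg)
qed

lemma bounded_linear_scaleC_right: "bounded_linear (\<lambda>x :: 'a::complex_hilbert. c *\<^sub>C x)"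
  by (rule bounded_linear_intro[where K = "cmod c"])
    (simp_all add: scaleC_add_right scaleR_scaleC scaleC_scaleC norm_scaleC mult.commute)

instantiation blinfun :: (real_normed_vector, complex_hilbert) complex_vector
begin
lift_definition scaleC_blinfun :: "complex \<Rightarrow> ('a \<Rightarrow>\<^sub>L 'b) \<Rightarrow> ('a \<Rightarrow>\<^sub>L 'b)" is "\<lambda>c f x. c *\<^sub>C f x"
  by (rule bounded_linear_compose[OF bounded_linear_scaleC_right])
instance
  by standard
    (transfer; simp add: fun_eq_iff scaleC_add_right scaleC_add_left scaleC_scaleC scaleC_one scaleR_scaleC)+
end

definition orth_proj :: "'a::complex_hilbert set \<Rightarrow> 'a \<Rightarrow> 'a" where
  "orth_proj M x = (THE y. y \<in> M \<and> (\<forall>z\<in>M. cinner (x - y) z = 0))"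

lemma csubspace_imp_subspace: "csubspace M \<Longrightarrow> subspace M"
  by (auto simp: complex_vector.subspace_def subspace_def scaleR_scaleC)

lemma orth_proj_ex:
  fixes M :: "'a::complex_hilbert set"
  assumes "closed M" "csubspace M"
  shows "\<exists>y\<in>M. \<forall>z\<in>M. cinner (x - y) z = 0"
proof -
  have sub: "subspace M" by (rule csubspace_imp_subspace[OF assms(2)])
  then have ne: "M \<noteq> {}" using subspace_0 by auto
  define d where "d = infdist x M"
  have d: "d \<le> norm (x - y)" if "y \<in> M" for y
    using infdist_le[OF that, of x] by (simp add: d_def dist_norm)
  have d0: "0 \<le> d" by (simp add: d_def infdist_nonneg)
  have "\<exists>y\<in>M. norm (x - y) < d + 1 / real (Suc n)" for n
  proof (rule ccontr)
    assume "\<not> ?thesis"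
    then have "d + 1 / real (Suc n) \<le> infdist x M"
      by (auto simp: infdist_notempty[OF ne] dist_norm not_less intro!: cINF_greatest[OF ne])
    then show False by (simp add: d_def)
  qed
  then obtain y where y: "\<And>n. y n \<in> M" "\<And>n. norm (x - y n) < d + 1 / real (Suc n)"
    by metis
  have para: "(norm (u - v))\<^sup>2 \<le> 2 * (norm (x - u))\<^sup>2 + 2 * (norm (x - v))\<^sup>2 - 4 * d\<^sup>2"
    if "u \<in> M" "v \<in> M" for u v
  proof -
    have "(1/2) *\<^sub>R (u + v) \<in> M"
      using that sub by (intro subspace_scale subspace_add)
    then have "d\<^sup>2 \<le> (norm (x - (1/2) *\<^sub>R (u + v)))\<^sup>2"
      using d d0 by (intro power_mono) auto
    then show ?thesis
      by (simp add: power2_norm_eq_inner inner_diff_left inner_diff_right inner_add_left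
          inner_add_right inner_commute field_simps)
  qed
  have lim: "(\<lambda>n. norm (x - y n)) \<longlonglongrightarrow> d"
  proof (rule tendsto_sandwich[where f = "\<lambda>_. d" and h = "\<lambda>n. d + 1 / real (Suc n)"])
    show "(\<lambda>n. d + 1 / real (Suc n)) \<longlonglongrightarrow> d"
      using tendsto_add[OF tendsto_const LIMSEQ_inverse_real_of_nat, of d]
      by (simp add: inverse_eq_divide)
    show "(\<lambda>n. d) \<longlonglongrightarrow> d" by simp
    show "\<forall>\<^sub>F n in sequentially. d \<le> norm (x - y n)" using d y(1) by simp
    show "\<forall>\<^sub>F n in sequentially. norm (x - y n) \<le> d + 1 / real (Suc n)"
      using y(2) by (simp add: less_imp_le)
  qed
  have "Cauchy y"
  proof (rule metric_CauchyI)
    fix e :: real assume e: "0 < e"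
    have "(\<lambda>n. (norm (x - y n))\<^sup>2) \<longlonglongrightarrow> d\<^sup>2" by (intro tendsto_intros lim)
    moreover have "d\<^sup>2 < d\<^sup>2 + e\<^sup>2 / 4" using e by simp
    ultimately have "\<forall>\<^sub>F n in sequentially. (norm (x - y n))\<^sup>2 < d\<^sup>2 + e\<^sup>2 / 4"
      by (rule order_tendstoD(2))
    then obtain N where N: "\<And>n. n \<ge> N \<Longrightarrow> (norm (x - y n))\<^sup>2 < d\<^sup>2 + e\<^sup>2 / 4"
      by (auto simp: eventually_sequentially)
    have "dist (y i) (y j) < e" if "i \<ge> N" "j \<ge> N" for i j
    proof -
      have "(norm (y i - y j))\<^sup>2 < e\<^sup>2"
        using para[OF y(1)[of i] y(1)[of j]] N[OF that(1)] N[OF that(2)] by simp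
      then show ?thesis using e by (simp add: dist_norm power2_less_imp_less)
    qed
    then show "\<exists>N. \<forall>i\<ge>N. \<forall>j\<ge>N. dist (y i) (y j) < e" by blast
  qed
  then obtain p where p: "y \<longlonglongrightarrow> p"
    using Cauchy_convergent convergent_def by blast
  have pM: "p \<in> M" using assms(1) y(1) p closed_sequentially by blast
  have "norm (x - p) = d"
    using LIMSEQ_unique[OF tendsto_norm[OF tendsto_diff[OF tendsto_const p]] lim] .
  then have min: "norm (x - p) \<le> norm (x - z)" if "z \<in> M" for z using d[OF that] by simp
  have expand: "(norm (w - (inner w z / inner z z) *\<^sub>R z))\<^sup>2 =
      (norm w)\<^sup>2 - (inner w z)\<^sup>2 / inner z z" if "z \<noteq> 0" for w z :: 'a
    unfolding power2_norm_eq_inner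
    using that by (simp add: inner_diff_left inner_diff_right inner_commute[of z w] power2_eq_square)
  have orth: "inner (x - p) z = 0" if z: "z \<in> M" for z
  proof (cases "z = 0")
    case False
    define t where "t = inner (x - p) z / inner z z"
    have "p + t *\<^sub>R z \<in> M" using pM z sub by (intro subspace_add subspace_scale)
    then have "(norm (x - p))\<^sup>2 \<le> (norm ((x - p) - (inner (x - p) z / inner z z) *\<^sub>R z))\<^sup>2"
      using min unfolding t_def by (intro power_mono) (simp_all add: diff_diff_eq)
    also have "\<dots> = (norm (x - p))\<^sup>2 - (inner (x - p) z)\<^sup>2 / inner z z"
      using False by (rule expand)
    finally have "(inner (x - p) z)\<^sup>2 / inner z z \<le> 0" by simp
    moreover have "inner z z > 0" using False by simp
    ultimately show ?thesis by (simp add: divide_le_0_iff)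
  qed simp
  have "cinner (x - p) z = 0" if z: "z \<in> M" for z
  proof -
    have "\<i> *\<^sub>C z \<in> M" using z assms(2) by (simp add: complex_vector.subspace_def)
    then show ?thesis
      using orth[of z] orth[of "\<i> *\<^sub>C z"] z
      by (simp add: inner_eq_Re_cinner cinner_scaleC_right complex_eq_iff)
  qed
  with pM show ?thesis by blast
qed

lemma orth_proj:
  fixes M :: "'a::complex_hilbert set"
  assumes "closed M" "csubspace M"
  shows "orth_proj M x \<in> M" and "\<And>z. z \<in> M \<Longrightarrow> cinner (x - orth_proj M x) z = 0"
proof -
  have "\<exists>!y. y \<in> M \<and> (\<forall>z\<in>M. cinner (x - y) z = 0)"
  proof (rule ex_ex1I)
    show "\<exists>y. y \<in> M \<and> (\<forall>z\<in>M. cinner (x - y) z = 0)" using orth_proj_ex[OF assms] by blast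
    fix y y' assume y: "y \<in> M \<and> (\<forall>z\<in>M. cinner (x - y) z = 0)"
      and y': "y' \<in> M \<and> (\<forall>z\<in>M. cinner (x - y') z = 0)"
    have M: "y - y' \<in> M" using y y' assms(2) by (simp add: complex_vector.subspace_diff)
    have "inner (y - y') (y - y') = inner (x - y') (y - y') - inner (x - y) (y - y')"
      by (simp add: inner_diff_left)
    also have "\<dots> = 0" using y y' M by (simp add: inner_eq_Re_cinner)
    finally show "y = y'" by simp
  qed
  from theI'[OF this] show "orth_proj M x \<in> M" "\<And>z. z \<in> M \<Longrightarrow> cinner (x - orth_proj M x) z = 0"
    by (auto simp: orth_proj_def)
qed

definition subspace_lattice :: "'a::complex_hilbert set set \<Rightarrow> bool" where
  "subspace_lattice L \<longleftrightarrow>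
     (\<forall>M\<in>L. closed M \<and> csubspace M) \<and> {0} \<in> L \<and> UNIV \<in> L \<and>
     (\<forall>S\<subseteq>L. \<Inter>S \<in> L) \<and> (\<forall>S\<subseteq>L. closure (cspan (\<Union>S)) \<in> L)"

definition commutative_subspace_lattice :: "'a::complex_hilbert set set \<Rightarrow> bool" where
  "commutative_subspace_lattice L \<longleftrightarrow> subspace_lattice L \<and>
     (\<forall>M\<in>L. \<forall>N\<in>L. orth_proj M \<circ> orth_proj N = orth_proj N \<circ> orth_proj M)"

text \<open>
  Elements of \<^typ>\<open>'a \<Rightarrow>\<^sub>L 'a\<close> are only real-linear in general, so complex linearity is imposed
  separately.
\<close>

definition alg :: "'a::complex_hilbert set set \<Rightarrow> ('a \<Rightarrow>\<^sub>L 'a) set" where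
  "alg L = {T. Vector_Spaces.linear scaleC scaleC (blinfun_apply T) \<and>
               (\<forall>M\<in>L. blinfun_apply T ` M \<subseteq> M)}"

text \<open>
  An operator algebra is given by its carrier \<open>\<A>\<close>; the values of a mapping outside \<open>\<A>\<close> are
  irrelevant.
\<close>

definition linear_map_on ::
  "('a::complex_hilbert \<Rightarrow>\<^sub>L 'a) set \<Rightarrow> (('a \<Rightarrow>\<^sub>L 'a) \<Rightarrow> ('a \<Rightarrow>\<^sub>L 'a)) \<Rightarrow> bool" where
  "linear_map_on \<A> \<delta> \<longleftrightarrow> \<delta> \<in> \<A> \<rightarrow> \<A> \<and>
     (\<forall>A\<in>\<A>. \<forall>B\<in>\<A>. \<delta> (A + B) = \<delta> A + \<delta> B) \<and>
     (\<forall>c. \<forall>A\<in>\<A>. \<delta> (c *\<^sub>C A) = c *\<^sub>C \<delta> A)"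

definition derivable_at_0 ::
  "int \<Rightarrow> int \<Rightarrow> ('a::complex_hilbert \<Rightarrow>\<^sub>L 'a) set \<Rightarrow> (('a \<Rightarrow>\<^sub>L 'a) \<Rightarrow> ('a \<Rightarrow>\<^sub>L 'a)) \<Rightarrow> bool" where
  "derivable_at_0 m n \<A> \<delta> \<longleftrightarrow> linear_map_on \<A> \<delta> \<and>
     (\<forall>A\<in>\<A>. \<forall>B\<in>\<A>. A o\<^sub>L B = 0 \<longrightarrow>
        of_int m *\<^sub>C \<delta> (A o\<^sub>L B) + of_int n *\<^sub>C \<delta> (B o\<^sub>L A) =
        of_int m *\<^sub>C (\<delta> A o\<^sub>L B) + of_int m *\<^sub>C (A o\<^sub>L \<delta> B) +
        of_int n *\<^sub>C (\<delta> B o\<^sub>L A) + of_int n *\<^sub>C (B o\<^sub>L \<delta> A))"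

definition derivation_on ::
  "('a::complex_hilbert \<Rightarrow>\<^sub>L 'a) set \<Rightarrow> (('a \<Rightarrow>\<^sub>L 'a) \<Rightarrow> ('a \<Rightarrow>\<^sub>L 'a)) \<Rightarrow> bool" where
  "derivation_on \<A> \<delta> \<longleftrightarrow> linear_map_on \<A> \<delta> \<and>
     (\<forall>A\<in>\<A>. \<forall>B\<in>\<A>. \<delta> (A o\<^sub>L B) = (\<delta> A o\<^sub>L B) + (A o\<^sub>L \<delta> B))"

end

theory Submission
  imports Defs
begin

text \<open>
  For an idempotent \<open>p\<close> the zero products \<open>(xp)(1 - p)\<close>, \<open>(x(1 - p))p\<close> and their mirror images give
  the Jordan identity \<open>\<delta>(xp + px) = \<delta>(x)p + x\<delta>(p) + \<delta>(p)x + p\<delta>(x)\<close> for all \<open>x\<close>. The elements that can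
  stand for \<open>p\<close> here form a norm-closed subspace \<open>V\<close>. It contains the ideals \<open>P alg L (1 - P)\<close>, \<open>P \<in> L\<close>,
  whose elements are differences of idempotents, and the diagonal (the commutant of the lattice),
  in which linear combinations of projections are dense.

  On \<open>P alg L (1 - P)\<close> triangularity turns the Jordan identity into the Leibniz rule, so each defect
  \<open>\<delta>(ab) - \<delta>(a)b - a\<delta>(b)\<close> annihilates these ideals from the left, hence also the projection \<open>1 - C\<close> onto
  the closed span of their ranges. The corner \<open>C alg L C\<close> lies in the diagonal; it is self-adjoint,
  hence semiprime, and there Bresar's theorem on Jordan derivations yields the Leibniz rule. This
  gives the Leibniz rule for all pairs \<open>(a, bC)\<close>, so the defects annihilate \<open>C\<close> as well.
\<close>

section \<open>Jordan derivations of semiprime rings\<close>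

text \<open>This is where 2-torsion-freeness, indispensable for Jordan arguments, enters.\<close>

lemma double_cancel:
  fixes u v :: "'r::real_vector"
  assumes "u + u = v + v"
  shows "u = v"
proof -
  have "2 *\<^sub>R u = 2 *\<^sub>R v" using assms by (simp add: scaleR_2)
  then show ?thesis by simp
qed

text \<open>The linearised form of \<open>f (x * x) = f x * x + x * f x\<close>. It is stated for
  one pair at a time because it becomes available for all \<open>x\<close> but at first only for
  \<open>y\<close> in a certain subspace.\<close>

definition jordan_pair :: "('r::ring \<Rightarrow> 'r) \<Rightarrow> 'r \<Rightarrow> 'r \<Rightarrow> bool" where
  "jordan_pair f x y \<longleftrightarrow> f (x * y + y * x) = f x * y + x * f y + f y * x + y * f x"

definition leibniz_pair :: "('r::ring \<Rightarrow> 'r) \<Rightarrow> 'r \<Rightarrow> 'r \<Rightarrow> bool" where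
  "leibniz_pair f x y \<longleftrightarrow> f (x * y) = f x * y + x * f y"

locale semiprime_subring =
  fixes M :: "'r::real_algebra set"
  assumes add: "\<And>x y. x \<in> M \<Longrightarrow> y \<in> M \<Longrightarrow> x + y \<in> M"
    and diff: "\<And>x y. x \<in> M \<Longrightarrow> y \<in> M \<Longrightarrow> x - y \<in> M"
    and mult: "\<And>x y. x \<in> M \<Longrightarrow> y \<in> M \<Longrightarrow> x * y \<in> M"
    and semiprime: "\<And>x. x \<in> M \<Longrightarrow> (\<And>y. y \<in> M \<Longrightarrow> x * y * x = 0) \<Longrightarrow> x = 0"
begin

text \<open>Any product \<open>(q x p) y (q x p)\<close> contains the vanishing factor
  \<open>p y q\<close>.\<close>

lemma semiprime_swap:
  assumes p: "p \<in> M" and q: "q \<in> M" and pq: "\<And>x. x \<in> M \<Longrightarrow> p * x * q = 0" and x: "x \<in> M"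
  shows "q * x * p = 0"
proof (rule semiprime)
  show "q * x * p \<in> M" using p q x mult by simp
  fix y assume y: "y \<in> M"
  have "q * x * p * y * (q * x * p) = q * x * (p * y * q) * x * p" by (simp add: mult.assoc)
  then show "q * x * p * y * (q * x * p) = 0" using pq[OF y] by simp
qed

text \<open>Put \<open>w = p x q\<close>. Exchanging \<open>p\<close> and \<open>q\<close> around a
  middle element costs a sign; three exchanges lead from \<open>w y w\<close> back to itself, so it
  equals its own negative.\<close>

lemma semiprime_alternating:
  assumes p: "p \<in> M" and q: "q \<in> M" and alt: "\<And>x. x \<in> M \<Longrightarrow> p * x * q + q * x * p = 0" and x: "x \<in> M"
  shows "p * x * q = 0"
proof (rule semiprime)
  show "p * x * q \<in> M" using p q x mult by simp
  fix y assume y: "y \<in> M"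
  have neg: "q * z * p = - (p * z * q)" if "z \<in> M" for z
    using alt[OF that] by (metis add_eq_0_iff)
  have "p * x * q * y * (p * x * q) = p * x * (q * y * p) * x * q" by (simp add: mult.assoc)
  also have "\<dots> = - (p * (x * p * y) * q * x * q)" by (simp only: neg[OF y]) (simp add: mult.assoc)
  also have "\<dots> = q * (x * p * y) * p * x * q"
    using neg[of "x * p * y"] x y p mult by simp
  also have "\<dots> = (q * x * p) * y * (p * x * q)" by (simp add: mult.assoc)
  also have "\<dots> = - (p * x * q * y * (p * x * q))" by (simp add: neg[OF x])
  finally have "p * x * q * y * (p * x * q) + p * x * q * y * (p * x * q) = 0 + 0"
    by (simp add: add_eq_0_iff)
  then show "p * x * q * y * (p * x * q) = 0" by (rule double_cancel)
qed

end

locale jordan_derivation = semiprime_subring +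
  fixes f :: "'r::real_algebra \<Rightarrow> 'r"
  assumes f_closed: "\<And>x. x \<in> M \<Longrightarrow> f x \<in> M"
    and f_add: "\<And>x y. x \<in> M \<Longrightarrow> y \<in> M \<Longrightarrow> f (x + y) = f x + f y"
    and jordan: "\<And>x y. x \<in> M \<Longrightarrow> y \<in> M \<Longrightarrow> jordan_pair f x y"
begin

lemmas f_jordan = jordan[unfolded jordan_pair_def]

lemma jordan_square:
  assumes "x \<in> M" shows "f (x * x) = f x * x + x * f x"
proof (rule double_cancel)
  show "f (x * x) + f (x * x) = (f x * x + x * f x) + (f x * x + x * f x)"
    using f_jordan[OF assms assms] f_add[of "x * x" "x * x"] assms mult by (simp add: add_ac)
qed

text \<open>With \<open>z = x y + y x\<close>, the element \<open>x z + z x\<close> is also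
  \<open>(x x y + y x x) + 2 x y x\<close>. Evaluating \<open>f\<close> on both forms isolates
  \<open>f (x y x)\<close>.\<close>

lemma jordan_triple:
  assumes x: "x \<in> M" and y: "y \<in> M"
  shows "f (x * y * x) = f x * y * x + x * f y * x + x * y * f x"
proof (rule double_cancel)
  let ?z = "x * y + y * x"
  have z: "?z \<in> M" using x y mult add by simp
  have split: "x * ?z + ?z * x = (x * x * y + y * (x * x)) + (x * y * x + x * y * x)"
    by (simp add: algebra_simps)
  have "f (x * ?z + ?z * x) = f (x * x * y + y * (x * x)) + (f (x * y * x) + f (x * y * x))"
    unfolding split using x y mult add by (simp add: f_add)
  then have "f (x * y * x) + f (x * y * x) = f (x * ?z + ?z * x) - f (x * x * y + y * (x * x))"
    by (simp add: algebra_simps)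
  also have "f (x * ?z + ?z * x) = f x * ?z + x * f ?z + f ?z * x + ?z * f x"
    by (rule f_jordan[OF x z])
  also have "f ?z = f x * y + x * f y + f y * x + y * f x" by (rule f_jordan[OF x y])
  also have "f (x * x * y + y * (x * x)) =
      (f x * x + x * f x) * y + x * x * f y + f y * (x * x) + y * (f x * x + x * f x)"
    using f_jordan[of "x * x" y] x y mult by (simp add: jordan_square)
  finally show "f (x * y * x) + f (x * y * x) =
      (f x * y * x + x * f y * x + x * y * f x) + (f x * y * x + x * f y * x + x * y * f x)"
    by (simp add: algebra_simps)
qed

lemma jordan_triple_polarized:
  assumes x: "x \<in> M" and y: "y \<in> M" and z: "z \<in> M"
  shows "f (x * y * z + z * y * x) =
    f x * y * z + x * f y * z + x * y * f z + f z * y * x + z * f y * x + z * y * f x"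
proof -
  have split: "(x + z) * y * (x + z) = (x * y * z + z * y * x) + (x * y * x + z * y * z)"
    by (simp add: algebra_simps)
  have "f ((x + z) * y * (x + z)) = f (x * y * z + z * y * x) + (f (x * y * x) + f (z * y * z))"
    unfolding split using x y z mult add by (simp add: f_add)
  then have "f (x * y * z + z * y * x) =
      f ((x + z) * y * (x + z)) - (f (x * y * x) + f (z * y * z))"
    by (simp add: algebra_simps)
  also have "\<dots> = (f x + f z) * y * (x + z) + (x + z) * f y * (x + z) + (x + z) * y * (f x + f z) -
      (f x * y * x + x * f y * x + x * y * f x + (f z * y * z + z * f y * z + z * y * f z))"
    using x y z add by (simp only: jordan_triple f_add)
  finally show ?thesis by (simp add: algebra_simps)
qed

abbreviation defect :: "'r \<Rightarrow> 'r \<Rightarrow> 'r" where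
  "defect a b \<equiv> f (a * b) - f a * b - a * f b"

abbreviation comm :: "'r \<Rightarrow> 'r \<Rightarrow> 'r" where
  "comm a b \<equiv> a * b - b * a"

lemma defect_closed: "a \<in> M \<Longrightarrow> b \<in> M \<Longrightarrow> defect a b \<in> M"
  and comm_closed: "a \<in> M \<Longrightarrow> b \<in> M \<Longrightarrow> comm a b \<in> M"
  using f_closed diff mult by simp_all

text \<open>The element \<open>?w\<close> is a sum of two nested triples, and it is also
  \<open>(a b) x (b a) + (b a) x (a b)\<close>. The triple identity and its polarisation give two
  values of \<open>f ?w\<close>, whose difference is the claim.\<close>

lemma defect_alternating:
  assumes a: "a \<in> M" and b: "b \<in> M" and x: "x \<in> M"
  shows "defect a b * x * comm a b + comm a b * x * defect a b = 0"
proof -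
  define p where "p = f (a * b)"
  let ?w = "a * (b * x * b) * a + b * (a * x * a) * b"
  \<comment> \<open>The Jordan identity makes the defect antisymmetric, so \<open>f (b * a)\<close>
    can be expressed through \<open>p\<close> as well.\<close>
  have ba: "f (b * a) = f a * b + a * f b + f b * a + b * f a - p"
    using f_jordan[OF a b] f_add[of "a * b" "b * a"] a b mult unfolding p_def
    by (simp add: algebra_simps)
  have 1: "f ?w = (f a * (b * x * b) * a + a * (f b * x * b + b * f x * b + b * x * f b) * a +
      a * (b * x * b) * f a) + (f b * (a * x * a) * b +
      b * (f a * x * a + a * f x * a + a * x * f a) * b + b * (a * x * a) * f b)"
    using a b x mult by (simp only: jordan_triple f_add)
  have "?w = (a * b) * x * (b * a) + (b * a) * x * (a * b)"
    by (simp add: mult.assoc)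
  then have 2: "f ?w = p * x * (b * a) + (a * b) * f x * (b * a) + (a * b) * x * f (b * a) +
      f (b * a) * x * (a * b) + (b * a) * f x * (a * b) + (b * a) * x * p"
    unfolding p_def using jordan_triple_polarized[of "a * b" x "b * a"] a b x mult by simp
  show ?thesis
    using trans[OF 1[symmetric] 2] unfolding ba p_def[symmetric] by (simp add: algebra_simps)
qed

lemma defect_times_comm:
  assumes "a \<in> M" "b \<in> M" "x \<in> M"
  shows "defect a b * x * comm a b = 0" and "comm a b * x * defect a b = 0"
proof -
  have *: "defect a b * x * comm a b = 0" if "x \<in> M" for x
    by (rule semiprime_alternating[OF defect_closed comm_closed defect_alternating])
      (use assms that in auto)
  show "defect a b * x * comm a b = 0" by (rule *[OF assms(3)])
  show "comm a b * x * defect a b = 0"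
    by (rule semiprime_swap[OF defect_closed comm_closed *]) (use assms in auto)
qed

text \<open>Polarisation in the first argument: inserting \<open>a + c\<close> shows that the
  product changes sign when \<open>a\<close> and \<open>c\<close> trade places. One such exchange
  inside its square creates the factor \<open>comm c b * y * defect c b\<close>, which is
  zero.\<close>

lemma defect_times_comm_left:
  assumes a: "a \<in> M" and b: "b \<in> M" and c: "c \<in> M" and x: "x \<in> M"
  shows "defect a b * x * comm c b = 0"
proof (rule semiprime)
  show "defect a b * x * comm c b \<in> M" using a b c x mult defect_closed comm_closed by simp
  fix y assume y: "y \<in> M"
  have "defect (a + c) b * x * comm (a + c) b = 0"
    using defect_times_comm(1)[of "a + c" b x] a b c x add by simp
  then have "defect a b * x * comm c b = - (defect c b * x * comm a b) -
      defect a b * x * comm a b - defect c b * x * comm c b"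
    using a b c mult by (simp add: f_add algebra_simps)
  then have "defect a b * x * comm c b = - (defect c b * x * comm a b)"
    using defect_times_comm(1) a b c x by simp
  then have "defect a b * x * comm c b * y * (defect a b * x * comm c b) =
      defect a b * x * comm c b * y * - (defect c b * x * comm a b)"
    by (rule arg_cong)
  also have "\<dots> = - (defect a b * x * (comm c b * y * defect c b) * x * comm a b)"
    by (simp only: mult.assoc mult_minus_right)
  finally have "defect a b * x * comm c b * y * (defect a b * x * comm c b) =
      - (defect a b * x * (comm c b * y * defect c b) * x * comm a b)" .
  then show "defect a b * x * comm c b * y * (defect a b * x * comm c b) = 0"
    using defect_times_comm(2)[OF c b y] by simp
qed

text \<open>The same polarisation, now in the second argument with \<open>b + d\<close>.\<close>

lemma defect_times_any_comm:
  assumes a: "a \<in> M" and b: "b \<in> M" and c: "c \<in> M" and d: "d \<in> M" and x: "x \<in> M"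
  shows "defect a b * x * comm c d = 0"
proof (rule semiprime)
  show "defect a b * x * comm c d \<in> M" using a b c d x mult defect_closed comm_closed by simp
  fix y assume y: "y \<in> M"
  have "defect a (b + d) * x * comm c (b + d) = 0"
    using defect_times_comm_left[of a "b + d" c x] a b c d x add by simp
  then have "defect a b * x * comm c d = - (defect a d * x * comm c b) -
      defect a b * x * comm c b - defect a d * x * comm c d"
    using a b c d mult by (simp add: f_add algebra_simps)
  then have "defect a b * x * comm c d = - (defect a d * x * comm c b)"
    using defect_times_comm_left a b c d x by simp
  then have "defect a b * x * comm c d * y * (defect a b * x * comm c d) =
      defect a b * x * comm c d * y * - (defect a d * x * comm c b)"
    by (rule arg_cong)
  also have "\<dots> = - (defect a b * x * (comm c d * y * defect a d) * x * comm c b)"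
    by (simp only: mult.assoc mult_minus_right)
  finally have "defect a b * x * comm c d * y * (defect a b * x * comm c d) =
      - (defect a b * x * (comm c d * y * defect a d) * x * comm c b)" .
  moreover have "comm c d * y * defect a d = 0"
    by (rule semiprime_swap[OF defect_closed comm_closed defect_times_comm_left])
      (use a c d y in auto)
  ultimately show "defect a b * x * comm c d * y * (defect a b * x * comm c d) = 0"
    by simp
qed

text \<open>
  Bresar's argument: the defect \<open>p\<close> annihilates all commutators and is therefore central; applying
  \<open>f\<close> to \<open>p * comm a b = 0\<close> gives \<open>p * p * p = 0\<close>.
\<close>

theorem leibniz:
  assumes a: "a \<in> M" and b: "b \<in> M"
  shows "leibniz_pair f a b"
proof -
  define p where "p = defect a b"
  have p: "p \<in> M" unfolding p_def by (rule defect_closed[OF a b])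
  have kill: "p * x * comm c d = 0" if "c \<in> M" "d \<in> M" "x \<in> M" for c d x
    unfolding p_def using defect_times_any_comm a b that by blast
  have central: "p * c = c * p" if c: "c \<in> M" for c
  proof -
    have "comm p c = 0"
    proof (rule semiprime)
      show "comm p c \<in> M" by (rule comm_closed[OF p c])
      fix y assume y: "y \<in> M"
      \<comment> \<open>Expanding only the left commutator puts \<open>p\<close> in front of
        \<open>comm p c\<close> in both terms, which is the situation of
        \<open>kill\<close>.\<close>
      have "comm p c * y * comm p c = p * (c * y) * comm p c - c * (p * y * comm p c)"
        by (simp add: algebra_simps)
      then show "comm p c * y * comm p c = 0" using kill p c y mult by simp
    qed
    then show ?thesis by simp
  qed
  let ?c = "comm a b"
  have cM: "?c \<in> M" by (rule comm_closed[OF a b])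
  have pc: "p * ?c = 0"
  proof (rule semiprime)
    show "p * ?c \<in> M" using p cM mult by simp
    fix y assume y: "y \<in> M"
    have "p * ?c * y * (p * ?c) = p * (?c * y * p) * ?c" by (simp add: mult.assoc)
    then show "p * ?c * y * (p * ?c) = 0" using kill[OF a b] mult p cM y by simp
  qed
  have cp: "?c * p = 0" using central[OF cM] pc by simp
  have zero: "f 0 = 0" using f_add[of 0 0] diff[OF a a] by simp
  have 1: "f p * ?c + p * f ?c + f ?c * p + ?c * f p = 0"
    using f_jordan[OF p cM] unfolding pc cp by (simp add: zero)
  have f_diff: "f x = f (x - y) + f y" if "x \<in> M" "y \<in> M" for x y
    using f_add[of "x - y" y] that diff by simp
  have fab: "f (a * b) = p + f a * b + a * f b" unfolding p_def by simp
  have fba: "f (b * a) = f b * a + b * f a - p"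
    using f_jordan[OF a b] f_add[of "a * b" "b * a"] a b mult unfolding fab
    by (simp add: algebra_simps)
  \<comment> \<open>The defects of \<open>(a, b)\<close> and \<open>(b, a)\<close> are
    \<open>p\<close> and \<open>- p\<close>, so the commutator picks up \<open>p\<close>
    twice.\<close>
  have fc: "f ?c = p + p + comm (f a) b + comm a (f b)"
    using f_diff[of "a * b" "b * a"] a b mult unfolding fab fba by (simp add: algebra_simps)
  \<comment> \<open>The second factor \<open>p\<close> serves as the middle element in
    \<open>kill\<close>, which removes both remaining commutators.\<close>
  have "p * p * f ?c = p * p * (p + p) + p * p * comm (f a) b + p * p * comm a (f b)"
    unfolding fc by (simp add: algebra_simps)
  then have 2: "p * p * f ?c = p * p * (p + p)"
    using kill[OF f_closed[OF a] b p] kill[OF a f_closed[OF b] p] by simp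
  have 3: "p * f p * ?c = 0" using central[OF f_closed[OF p]] pc by (simp add: mult.assoc)
  have 4: "p * f ?c * p = p * p * f ?c" using central[OF f_closed[OF cM]] by (metis mult.assoc)
  \<comment> \<open>Of the four terms the outer two vanish by 3 and \<open>pc\<close>, and the inner
    two both equal \<open>p p (p + p)\<close>; hence four times the cube of \<open>p\<close> is
    zero.\<close>
  have "p * f p * ?c + p * p * f ?c + p * f ?c * p + p * ?c * f p = 0"
    using arg_cong[OF 1, of "\<lambda>z. p * z"] by (simp only: distrib_left mult.assoc mult_zero_right)
  then have "p * p * (p + p) + p * p * (p + p) = 0 + 0" by (simp add: 2 3 4 pc)
  then have "p * p * (p + p) = 0" by (rule double_cancel)
  then have "p * p * p + p * p * p = 0 + 0" by (simp add: algebra_simps)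
  then have ppp: "p * p * p = 0" by (rule double_cancel)
  \<comment> \<open>A central nilpotent element of a semiprime ring is zero; the exponent is lowered
    from 3 to 2 and then to 1.\<close>
  have pp: "p * p = 0"
  proof (rule semiprime)
    show "p * p \<in> M" using p mult by simp
    fix y assume y: "y \<in> M"
    have "p * p * y * (p * p) = p * (p * y) * p * p" by (simp add: mult.assoc)
    also have "\<dots> = p * (y * p) * p * p" by (simp add: central[OF y])
    also have "\<dots> = (p * y) * (p * p * p)" by (simp add: mult.assoc)
    finally show "p * p * y * (p * p) = 0" by (simp add: ppp)
  qed
  have "p = 0"
  proof (rule semiprime[OF p])
    fix y assume y: "y \<in> M"
    show "p * y * p = 0" using central[OF y] pp by (metis mult.assoc mult_zero_right)
  qed
  then show ?thesis by (simp add: fab leibniz_pair_def)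
qed

end

section \<open>Jordan maps on triangular algebras\<close>

locale additive_map_on =
  fixes A :: "'r::real_algebra set" and f :: "'r \<Rightarrow> 'r"
  assumes add: "\<And>x y. x \<in> A \<Longrightarrow> y \<in> A \<Longrightarrow> x + y \<in> A"
    and diff: "\<And>x y. x \<in> A \<Longrightarrow> y \<in> A \<Longrightarrow> x - y \<in> A"
    and mult: "\<And>x y. x \<in> A \<Longrightarrow> y \<in> A \<Longrightarrow> x * y \<in> A"
    and f_closed: "\<And>x. x \<in> A \<Longrightarrow> f x \<in> A"
    and f_add: "\<And>x y. x \<in> A \<Longrightarrow> y \<in> A \<Longrightarrow> f (x + y) = f x + f y"
begin

lemma f_diff: "x \<in> A \<Longrightarrow> y \<in> A \<Longrightarrow> f (x - y) = f x - f y"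
  using f_add[of "x - y" y] diff by simp

text \<open>Associativity: \<open>f\<close> of \<open>a b t\<close> is expanded once as
  \<open>(a b) t\<close> and once as \<open>a (b t)\<close>.\<close>

lemma leibniz_defect_mult:
  assumes "leibniz_pair f (a * b) t" "leibniz_pair f a (b * t)" "leibniz_pair f b t"
  shows "(f (a * b) - f a * b - a * f b) * t = 0"
proof -
  have "f (a * b) * t + a * b * f t = f a * (b * t) + a * (f b * t + b * f t)"
    using assms by (metis leibniz_pair_def mult.assoc)
  then show ?thesis by (simp add: algebra_simps)
qed

lemma subtract_inner:
  assumes "d \<in> A"
  shows "additive_map_on A (\<lambda>x. f x - (x * d - d * x))"
  by unfold_locales (use assms add diff mult f_closed in \<open>auto simp: f_add algebra_simps\<close>)

end

text \<open>The bracket \<open>x * d - d * x\<close> is an inner derivation and satisfies the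
  identity exactly.\<close>

lemma leibniz_pair_subtract_inner:
  "leibniz_pair (\<lambda>x. f x - (x * d - d * x)) x y \<longleftrightarrow> leibniz_pair f x y"
  for d :: "'r::ring"
  unfolding leibniz_pair_def by (simp add: algebra_simps)

lemma jordan_pair_subtract_inner:
  "jordan_pair (\<lambda>x. f x - (x * d - d * x)) x y \<longleftrightarrow> jordan_pair f x y"
  for d :: "'r::ring"
  unfolding jordan_pair_def by (simp add: algebra_simps)

text \<open>The condition \<open>inv\<close> says \<open>(1 - p) A p = 0\<close>, so
  \<open>A\<close> is block upper triangular along \<open>p\<close>. The normalisation
  \<open>f p = 0\<close> is reached later by subtracting an inner derivation.\<close>

locale triangular_jordan = additive_map_on A f for A :: "'r::real_algebra set" and f +
  fixes p :: 'r
  assumes p: "p \<in> A" and idem: "p * p = p" and inv: "\<And>x. x \<in> A \<Longrightarrow> p * x * p = x * p"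
    and fp: "f p = 0" and jordan_p: "\<And>x. x \<in> A \<Longrightarrow> jordan_pair f x p"
begin

lemma idem_right: "x * p * p = x * p"
  by (simp add: mult.assoc idem)

lemma f_jordan_p: "x \<in> A \<Longrightarrow> f (x * p + p * x) = f x * p + p * f x"
  using jordan_p fp by (simp add: jordan_pair_def)

text \<open>By \<open>inv\<close>, \<open>A p\<close> is the block \<open>p A p\<close>. This lemma,
  \<open>f_upper\<close> and \<open>f_lower\<close> show that \<open>f\<close> respects the blocks
  \<open>p A p\<close>, \<open>p A (1 - p)\<close> and \<open>(1 - p) A (1 - p)\<close>; each time
  the Jordan identity with \<open>p\<close> is compared with its own product with
  \<open>p\<close>.\<close>

lemma f_mult_p:
  assumes x: "x \<in> A"
  shows "f (x * p) * p = f (x * p)" and "p * f (x * p) = f (x * p)"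
proof -
  let ?g = "f (x * p)"
  have xp: "x * p \<in> A" using x p mult by simp
  have "x * p * p + p * (x * p) = x * p + x * p"
    using inv[OF x] by (simp add: mult.assoc idem)
  then have 1: "?g + ?g = ?g * p + p * ?g"
    using f_jordan_p[OF xp] f_add[OF xp xp] by simp
  have "p * ?g + p * ?g = ?g * p + p * ?g"
    using arg_cong[OF 1, of "\<lambda>z. p * z"] inv[OF f_closed[OF xp]]
    by (simp add: distrib_left mult.assoc[symmetric] idem)
  then have 2: "p * ?g = ?g * p" by simp
  show "?g * p = ?g" using 1 unfolding 2 by (rule double_cancel[OF sym])
  then show "p * ?g = ?g" using 2 by simp
qed

lemma f_upper:
  assumes z: "z \<in> A" and pz: "p * z = z" and zp: "z * p = 0"
  shows "p * f z = f z" and "f z * p = 0"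
proof -
  have 1: "f z = f z * p + p * f z" using f_jordan_p[OF z] pz zp by simp
  have "p * f z = f z * p + p * f z"
    using arg_cong[OF 1, of "\<lambda>z. p * z"] inv[OF f_closed[OF z]]
    by (simp add: distrib_left mult.assoc[symmetric] idem)
  then show 2: "f z * p = 0" by simp
  show "p * f z = f z" using 1 2 by simp
qed

lemma f_lower:
  assumes x: "x \<in> A" and px: "p * x = 0" and xp: "x * p = 0"
  shows "p * f x = 0" and "f x * p = 0"
proof -
  have "f 0 = 0" using f_add[of 0 0] diff[OF x x] by simp
  then have 1: "f x * p + p * f x = 0" using f_jordan_p[OF x] px xp by simp
  have "f x * p + f x * p = 0 + 0"
    using arg_cong[OF 1, of "\<lambda>z. z * p"] inv[OF f_closed[OF x]]
    by (simp add: distrib_right mult.assoc idem)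
  then show 2: "f x * p = 0" by (rule double_cancel)
  show "p * f x = 0" using 1 2 by simp
qed

text \<open>By \<open>inv\<close>, the element is \<open>p x (1 - p)\<close>, written without a
  unit.\<close>

lemma upper_part:
  assumes x: "x \<in> A"
  shows "p * x - x * p \<in> A" and "p * (p * x - x * p) = p * x - x * p" and "(p * x - x * p) * p = 0"
  using x p mult diff inv[OF x] by (auto simp: left_diff_distrib right_diff_distrib idem idem_right mult.assoc[symmetric])

text \<open>Write \<open>x p + p x\<close> as twice \<open>x p\<close> plus the upper part of
  \<open>x\<close>, apply \<open>f\<close>, and multiply by \<open>p\<close> on the right: the upper
  part disappears by \<open>f_upper\<close>.\<close>

lemma f_compress:
  assumes x: "x \<in> A"
  shows "f (x * p) = f x * p"
proof (rule double_cancel)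
  let ?z = "p * x - x * p"
  have xp: "x * p \<in> A" using x p mult by simp
  have "p * x \<in> A" using x p mult by simp
  then have "f (x * p + p * x) = f (x * p) + f (x * p) + f ?z"
    using xp by (simp add: f_add f_diff)
  then have "(f x * p + p * f x) * p = (f (x * p) + f (x * p) + f ?z) * p"
    using f_jordan_p[OF x] by simp
  then show "f (x * p) + f (x * p) = f x * p + f x * p"
    using f_upper(2)[OF upper_part[OF x]] f_mult_p(1)[OF x] inv[OF f_closed[OF x]]
    by (simp add: distrib_right mult.assoc idem)
qed

text \<open>Replacing \<open>x\<close> by \<open>x p\<close> leaves \<open>x t\<close> unchanged
  since \<open>p t = t\<close>, and kills all terms with \<open>t\<close> or \<open>f t\<close> on
  the left. What remains of the Jordan identity for \<open>(x p, t)\<close> is the Leibniz rule for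
  \<open>(x, t)\<close>.\<close>

lemma leibniz_upper:
  assumes x: "x \<in> A" and t: "t \<in> A" "p * t = t" "t * p = 0"
    and jordan_t: "\<And>y. y \<in> A \<Longrightarrow> jordan_pair f y t"
  shows "leibniz_pair f x t"
proof -
  have xp: "x * p \<in> A" using x p mult by simp
  have 1: "x * p * t = x * t" using t(2) by (simp add: mult.assoc)
  have "t * (x * p) = t * p * x * p" using inv[OF x] by (metis mult.assoc)
  then have 2: "t * (x * p) = 0" using t(3) by simp
  have "f t * (x * p) = f t * p * x * p" using inv[OF x] by (metis mult.assoc)
  then have 3: "f t * (x * p) = 0" using f_upper(2)[OF t] by simp
  have "t * f (x * p) = t * p * f (x * p)" using f_mult_p(2)[OF x] by (simp add: mult.assoc)
  then have 4: "t * f (x * p) = 0" using t(3) by simp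
  have 5: "x * p * f t = x * f t" using f_upper(1)[OF t] by (simp add: mult.assoc)
  have 6: "f (x * p) * t = f x * t" using f_compress[OF x] t(2) by (simp add: mult.assoc)
  show ?thesis
    using jordan_t[OF xp] unfolding jordan_pair_def leibniz_pair_def 1 2 3 4 5 6 by simp
qed

text \<open>Split \<open>x\<close> into \<open>x p\<close>, its upper part \<open>?z\<close>, and
  \<open>?y\<close> in the lower block. For \<open>x p\<close> every term vanishes; for
  \<open>?z\<close> the terms with \<open>t\<close> or \<open>f t\<close> on the left vanish, so
  Jordan becomes Leibniz; for \<open>?y\<close> the rule is assumed.\<close>

lemma leibniz_lower:
  assumes x: "x \<in> A" and t: "t \<in> A" "p * t = 0" "t * p = 0"
    and jordan_t: "\<And>y. y \<in> A \<Longrightarrow> jordan_pair f y t"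
    and leibniz_t: "\<And>y. y \<in> A \<Longrightarrow> p * y = 0 \<Longrightarrow> y * p = 0 \<Longrightarrow> leibniz_pair f y t"
  shows "leibniz_pair f x t"
proof -
  let ?z = "p * x - x * p" and ?y = "x - p * x"
  note z = upper_part[OF x]
  have y: "?y \<in> A" "p * ?y = 0" "?y * p = 0"
    using x p mult diff inv[OF x] by (auto simp: left_diff_distrib right_diff_distrib idem idem_right mult.assoc[symmetric])
  have xp: "x * p \<in> A" using x p mult by simp
  note ft = f_lower[OF t]
  have f0: "f 0 = 0" using f_add[of 0 0] diff[OF x x] by simp
  have "x * p * t = 0" "f (x * p) * t = 0" "x * p * f t = 0"
    using t(2) ft(1) f_compress[OF x] by (simp_all add: mult.assoc)
  then have 1: "leibniz_pair f (x * p) t" by (simp add: leibniz_pair_def f0)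
  have "t * ?z = t * p * ?z" "f t * ?z = f t * p * ?z" "t * f ?z = t * p * f ?z"
    using z(2) f_upper(1)[OF z] by (simp_all only: mult.assoc)
  then have "t * ?z = 0" "f t * ?z = 0" "t * f ?z = 0" using t(3) ft(2) by simp_all
  then have 2: "leibniz_pair f ?z t"
    using jordan_t[OF z(1)] by (simp add: jordan_pair_def leibniz_pair_def)
  have 3: "leibniz_pair f ?y t" using leibniz_t y by blast
  have "x * t = x * p * t + ?z * t + ?y * t" by (simp add: algebra_simps)
  then have "f (x * t) = f (x * p * t) + f (?z * t) + f (?y * t)"
    using xp z(1) y(1) t(1) add mult by (simp add: f_add)
  also have "\<dots> = (f (x * p) + f ?z + f ?y) * t + (x * p + ?z + ?y) * f t"
    by (simp only: 1[unfolded leibniz_pair_def] 2[unfolded leibniz_pair_def]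
        3[unfolded leibniz_pair_def] distrib_left distrib_right add_ac)
  also have "f (x * p) + f ?z + f ?y = f (x * p + ?z + ?y)"
    by (simp only: f_add add xp z(1) y(1))
  finally show ?thesis by (simp add: leibniz_pair_def)
qed

end

section \<open>Removing the normalisation and assembling the algebraic argument\<close>

context additive_map_on
begin

text \<open>
  Since \<open>f p = p * f p\<close> and \<open>f p * p = 0\<close>, the commutator of \<open>p\<close> with \<open>f p\<close> is \<open>f p\<close>; subtracting this
  inner derivation normalises \<open>f\<close> to vanish at \<open>p\<close>.
\<close>

lemma triangular_jordan_subtract_inner:
  assumes p: "p \<in> A" and idem: "p * p = p" and inv: "\<And>x. x \<in> A \<Longrightarrow> p * x * p = x * p"
    and jordan_p: "\<And>x. x \<in> A \<Longrightarrow> jordan_pair f x p"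
  shows "triangular_jordan A (\<lambda>x. f x - (x * f p - f p * x)) p"
proof -
  let ?d = "f p"
  have d: "?d \<in> A" using p f_closed by simp
  interpret g: additive_map_on A "\<lambda>x. f x - (x * f p - f p * x)"
    by (rule subtract_inner[OF d])
  have "?d + ?d = (?d * p + p * ?d) + (?d * p + p * ?d)"
    using jordan_p[OF p] p by (simp add: jordan_pair_def idem f_add add_ac)
  then have 1: "?d = ?d * p + p * ?d" by (rule double_cancel)
  have "p * ?d = ?d * p + p * ?d"
    using arg_cong[OF 1, of "\<lambda>z. p * z"] inv[OF d]
    by (simp add: distrib_left mult.assoc[symmetric] idem)
  then have 2: "?d * p = 0" by simp
  with 1 have 3: "p * ?d = ?d" by simp
  show ?thesis
    by unfold_locales (use assms 2 3 in \<open>auto simp: jordan_pair_subtract_inner\<close>)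
qed

lemma leibniz_of_jordan_upper:
  assumes "p \<in> A" and "p * p = p" and "\<And>x. x \<in> A \<Longrightarrow> p * x * p = x * p"
    and "\<And>x. x \<in> A \<Longrightarrow> jordan_pair f x p"
    and "t \<in> A" "p * t = t" "t * p = 0" and "\<And>x. x \<in> A \<Longrightarrow> jordan_pair f x t"
    and "x \<in> A"
  shows "leibniz_pair f x t"
proof -
  interpret g: triangular_jordan A "\<lambda>x. f x - (x * f p - f p * x)" p
    by (rule triangular_jordan_subtract_inner) (use assms in auto)
  show ?thesis
    using g.leibniz_upper[of x t] assms
    by (simp add: jordan_pair_subtract_inner leibniz_pair_subtract_inner)
qed

text \<open>The two-sided annihilator of \<open>p\<close> in \<open>A\<close> is the lower block.
  The normalised map preserves it by \<open>f_lower\<close>, so Bresar's theorem applies there, and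
  \<open>leibniz_lower\<close> extends the first argument to all of \<open>A\<close>.\<close>

lemma leibniz_of_jordan_lower:
  assumes p: "p \<in> A" and idem: "p * p = p" and inv: "\<And>x. x \<in> A \<Longrightarrow> p * x * p = x * p"
    and jordan_p: "\<And>x. x \<in> A \<Longrightarrow> jordan_pair f x p"
    and semiprime: "\<And>x. x \<in> A \<Longrightarrow> p * x = 0 \<Longrightarrow> x * p = 0 \<Longrightarrow>
      (\<And>y. y \<in> A \<Longrightarrow> p * y = 0 \<Longrightarrow> y * p = 0 \<Longrightarrow> x * y * x = 0) \<Longrightarrow> x = 0"
    and jordan: "\<And>x y. x \<in> A \<Longrightarrow> y \<in> A \<Longrightarrow> p * y = 0 \<Longrightarrow> y * p = 0 \<Longrightarrow> jordan_pair f x y"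
    and t: "t \<in> A" "p * t = 0" "t * p = 0" and x: "x \<in> A"
  shows "leibniz_pair f x t"
proof -
  let ?f = "\<lambda>x. f x - (x * f p - f p * x)"
  let ?M = "{x \<in> A. p * x = 0 \<and> x * p = 0}"
  interpret g: triangular_jordan A ?f p
    by (rule triangular_jordan_subtract_inner) (use assms in auto)
  interpret corner: jordan_derivation ?M ?f
  proof
    fix x y assume x: "x \<in> ?M" and y: "y \<in> ?M"
    show "x + y \<in> ?M" using x y add by (auto simp: algebra_simps)
    show "x - y \<in> ?M" using x y diff by (auto simp: algebra_simps)
    show "x * y \<in> ?M" using x y mult by (auto simp: mult.assoc) (auto simp: mult.assoc[symmetric])
    show "?f x \<in> ?M" using x g.f_closed[of x] g.f_lower[of x] by blast
    show "?f (x + y) = ?f x + ?f y" using x y by (intro g.f_add) auto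
    show "jordan_pair ?f x y" using x y jordan by (simp add: jordan_pair_subtract_inner)
  next
    fix x assume "x \<in> ?M" and "\<And>y. y \<in> ?M \<Longrightarrow> x * y * x = 0"
    then show "x = 0" using semiprime[of x] by blast
  qed
  have "leibniz_pair ?f x t"
    by (rule g.leibniz_lower[OF x t]) (use corner.leibniz t jordan in \<open>auto simp: jordan_pair_subtract_inner\<close>)
  then show ?thesis by (simp add: leibniz_pair_subtract_inner)
qed

text \<open>The whole argument without topology. In the application \<open>P\<close> consists of the
  lattice projections and \<open>c\<close> is the projection onto the orthogonal complement of the
  ranges of all elements of \<open>P alg L (1 - P)\<close>.\<close>

theorem leibniz_of_jordan:
  assumes u: "u \<in> A" "\<And>x. u * x = x" "\<And>x. x * u = x"
    and V: "V \<subseteq> A" "\<And>x y. x \<in> V \<Longrightarrow> y \<in> V \<Longrightarrow> x - y \<in> V"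
    and V_jordan: "\<And>x v. x \<in> A \<Longrightarrow> v \<in> V \<Longrightarrow> jordan_pair f x v"
    and V_idem: "\<And>p. p \<in> A \<Longrightarrow> p * p = p \<Longrightarrow> p \<in> V"
    and P: "P \<subseteq> A" "\<And>p. p \<in> P \<Longrightarrow> p * p = p"
      "\<And>p x. p \<in> P \<Longrightarrow> x \<in> A \<Longrightarrow> p * x * p = x * p"
    and c: "c \<in> A" "c * c = c" "\<And>x. x \<in> A \<Longrightarrow> c * x * c = c * x"
    and separating: "\<And>d. d \<in> A \<Longrightarrow>
      (\<And>p t. p \<in> P \<Longrightarrow> t \<in> A \<Longrightarrow> p * t = t \<Longrightarrow> t * p = 0 \<Longrightarrow> d * t = 0) \<Longrightarrow> d * c = d"
    and corner_V: "\<And>x. x \<in> A \<Longrightarrow> c * x = x \<Longrightarrow> x * c = x \<Longrightarrow> x \<in> V"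
    and semiprime: "\<And>x. x \<in> A \<Longrightarrow> c * x = x \<Longrightarrow> x * c = x \<Longrightarrow>
      (\<And>y. y \<in> A \<Longrightarrow> c * y = y \<Longrightarrow> y * c = y \<Longrightarrow> x * y * x = 0) \<Longrightarrow> x = 0"
    and a: "a \<in> A" and b: "b \<in> A"
  shows "leibniz_pair f a b"
proof -
  have upper: "leibniz_pair f x t"
    if p: "p \<in> A" "p * p = p" "\<And>x. x \<in> A \<Longrightarrow> p * x * p = x * p"
      and t: "t \<in> A" "p * t = t" "t * p = 0" and x: "x \<in> A" for p t x
  proof (rule leibniz_of_jordan_upper[OF p _ t _ x])
    fix y assume y: "y \<in> A"
    show "jordan_pair f y p" using V_jordan[OF y V_idem] p by blast
    \<comment> \<open>Since \<open>t\<close> squares to zero, \<open>p + t\<close> is an idempotent,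
      and \<open>t\<close> is a difference of two idempotents.\<close>
    have "t * t = t * p * t" using t(2) by (simp add: mult.assoc)
    then have "(p + t) * (p + t) = p + t" using p(2) t by (simp add: algebra_simps)
    then have "p + t - p \<in> V" using p t add by (intro V V_idem) auto
    then show "jordan_pair f y t" using V_jordan[OF y] by simp
  qed
  \<comment> \<open>Coinvariance of \<open>c\<close> is invariance of its complement, so
    \<open>?e\<close> can replace \<open>p\<close> in the triangular results, with
    \<open>c A c\<close> as the lower block.\<close>
  let ?e = "u - c"
  have e: "?e \<in> A" "?e * ?e = ?e" using u c diff by (auto simp: algebra_simps)
  have e_inv: "?e * x * ?e = x * ?e" if "x \<in> A" for x
    using c(3)[OF that] u by (simp add: algebra_simps)
  have corner: "c * x = x \<and> x * c = x \<longleftrightarrow> ?e * x = 0 \<and> x * ?e = 0" for x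
    using u by (auto simp: algebra_simps)
  have lower: "leibniz_pair f x t" if x: "x \<in> A" and t: "t \<in> A" "c * t = t" "t * c = t" for x t
  proof (rule leibniz_of_jordan_lower[OF e e_inv _ _ _ t(1) _ _ x])
    show "?e * t = 0" "t * ?e = 0" using t corner by blast+
    show "jordan_pair f y ?e" if "y \<in> A" for y using V_jordan[OF that V_idem[OF e]] .
    show "jordan_pair f y z" if "y \<in> A" "z \<in> A" "?e * z = 0" "z * ?e = 0" for y z
      using V_jordan corner_V corner that by blast
    show "y = 0" if "y \<in> A" "?e * y = 0" "y * ?e = 0"
      "\<And>z. z \<in> A \<Longrightarrow> ?e * z = 0 \<Longrightarrow> z * ?e = 0 \<Longrightarrow> y * z * y = 0" for y
      using semiprime[of y] that corner by blast
  qed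
  have mult_c: "leibniz_pair f x (y * c)" if x: "x \<in> A" and y: "y \<in> A" for x y
  proof -
    \<comment> \<open>The upper part and the lower part of \<open>y * c\<close> with respect to
      \<open>?e\<close>.\<close>
    let ?t = "?e * y * c" and ?s = "c * y * c"
    have t: "?t \<in> A" and s: "?s \<in> A" using e(1) y c(1) mult by auto
    have "?e * ?t = ?t" "?t * ?e = 0"
      using e(2) u c(2) by (simp_all add: mult.assoc[symmetric]) (simp add: algebra_simps)
    then have 1: "leibniz_pair f x ?t" using upper[OF e e_inv t _ _ x] by blast
    have 2: "leibniz_pair f x ?s" using c(2) by (intro lower x s) (auto simp: mult.assoc[symmetric], simp add: mult.assoc)
    have "y * c = ?t + ?s" using u by (simp add: algebra_simps)
    then show ?thesis using 1 2 x t s mult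
      by (simp add: leibniz_pair_def distrib_left f_add add_ac)
  qed
  let ?d = "f (a * b) - f a * b - a * f b"
  have d: "?d \<in> A" using a b mult diff f_closed by simp
  have "?d * c = ?d"
  proof (rule separating[OF d])
    fix p t assume p: "p \<in> P" and t: "t \<in> A" "p * t = t" "t * p = 0"
    \<comment> \<open>By invariance \<open>b t\<close> stays in the ideal of \<open>t\<close>, so
      all three pairs required by \<open>leibniz_defect_mult\<close> are covered by
      \<open>upper\<close>.\<close>
    have bt: "b * t \<in> A" "b * t * p = 0" using b t mult by (auto simp: mult.assoc)
    have "p * (b * t) = p * b * p * t" using t(2) by (simp add: mult.assoc)
    also have "\<dots> = b * t" using P(3)[OF p b] t(2) by (simp add: mult.assoc)
    finally have "p * (b * t) = b * t" .
    then show "?d * t = 0" using p P bt t a b mult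
      by (intro leibniz_defect_mult upper[of p]) auto
  qed
  moreover have "?d * c = 0"
    \<comment> \<open>Here \<open>t = c\<close>; taking \<open>y = u\<close> in
      \<open>mult_c\<close> yields \<open>c\<close> itself as second argument.\<close>
    using mult_c[of "a * b" u] mult_c[of b u] mult_c[of a b] u a b mult
    by (intro leibniz_defect_mult) auto
  ultimately show ?thesis by (simp add: leibniz_pair_def algebra_simps)
qed

end

text \<open>Subtracting 1 from 2 cancels \<open>f (p x p)\<close> and gives 5; likewise 3 and 4 give
  6, which is 5 with \<open>m\<close> and \<open>n\<close> exchanged. The sum of 5 and 6 is
  \<open>m + n\<close> times the Jordan identity.\<close>

lemma (in additive_map_on) jordan_pair_idempotent:
  fixes m n :: real
  assumes mn: "m + n \<noteq> 0"
    and zero_product: "\<And>x y. x \<in> A \<Longrightarrow> y \<in> A \<Longrightarrow> x * y = 0 \<Longrightarrow>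
      n *\<^sub>R f (y * x) = m *\<^sub>R (f x * y + x * f y) + n *\<^sub>R (f y * x + y * f x)"
    and u: "u \<in> A" "\<And>x. u * x = x" "\<And>x. x * u = x" and fu: "f u = 0"
    and p: "p \<in> A" "p * p = p" and x: "x \<in> A"
  shows "jordan_pair f x p"
proof -
  have closed: "x * p \<in> A" "p * x \<in> A" "p * x * p \<in> A" "u - p \<in> A" "x - x * p \<in> A" "x - p * x \<in> A"
    using u p x mult diff by simp_all
  have fq: "f (u - p) = - f p" using f_diff[OF u(1) p(1)] fu by simp
  have pp: "y * p * p = y * p" "p * (p * y) = p * y" for y
    using p(2) by (simp_all add: mult.assoc) (simp add: mult.assoc[symmetric])
  have 1: "n *\<^sub>R f ((u - p) * (x * p)) = m *\<^sub>R (f (x * p) * (u - p) + (x * p) * f (u - p)) +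
      n *\<^sub>R (f (u - p) * (x * p) + (u - p) * f (x * p))"
    by (rule zero_product) (use closed u pp in \<open>simp_all add: right_diff_distrib\<close>)
  have 2: "n *\<^sub>R f (p * (x - x * p)) = m *\<^sub>R (f (x - x * p) * p + (x - x * p) * f p) +
      n *\<^sub>R (f p * (x - x * p) + p * f (x - x * p))"
    by (rule zero_product) (use closed p pp in \<open>simp_all add: left_diff_distrib\<close>)
  have 3: "n *\<^sub>R f ((p * x) * (u - p)) = m *\<^sub>R (f (u - p) * (p * x) + (u - p) * f (p * x)) +
      n *\<^sub>R (f (p * x) * (u - p) + (p * x) * f (u - p))"
    by (rule zero_product) (use closed u pp in \<open>simp_all add: left_diff_distrib\<close>)
  have 4: "n *\<^sub>R f ((x - p * x) * p) = m *\<^sub>R (f p * (x - p * x) + p * f (x - p * x)) +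
      n *\<^sub>R (f (x - p * x) * p + (x - p * x) * f p)"
    by (rule zero_product) (use closed p pp in \<open>simp_all add: right_diff_distrib\<close>)
  note expand = fq f_diff closed p(1) x u left_diff_distrib right_diff_distrib mult.assoc
  have 5: "m *\<^sub>R f (x * p) + n *\<^sub>R f (p * x) =
      m *\<^sub>R (f x * p + x * f p) + n *\<^sub>R (f p * x + p * f x)"
    using 1 2 closed by (simp add: expand scaleR_right_diff_distrib scaleR_add_right algebra_simps)
  have 6: "m *\<^sub>R f (p * x) + n *\<^sub>R f (x * p) =
      m *\<^sub>R (f p * x + p * f x) + n *\<^sub>R (f x * p + x * f p)"
    using 3 4 closed by (simp add: expand scaleR_right_diff_distrib scaleR_add_right algebra_simps)
  have "(m + n) *\<^sub>R (f (x * p) + f (p * x)) =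
      (m *\<^sub>R f (x * p) + n *\<^sub>R f (p * x)) + (m *\<^sub>R f (p * x) + n *\<^sub>R f (x * p))"
    by (simp add: algebra_simps)
  also have "\<dots> = (m + n) *\<^sub>R (f x * p + x * f p + f p * x + p * f x)"
    unfolding 5 6 by (simp add: algebra_simps)
  finally have "f (x * p) + f (p * x) = f x * p + x * f p + f p * x + p * f x"
    using mn by simp
  then show ?thesis using closed by (simp add: jordan_pair_def f_add)
qed

section \<open>Adjoints and projections\<close>

definition clinear :: "('a::complex_hilbert \<Rightarrow>\<^sub>L 'a) \<Rightarrow> bool" where
  "clinear T \<longleftrightarrow> (\<forall>c x. T (c *\<^sub>C x) = c *\<^sub>C T x)"

text \<open>A relation, so no adjoint has to be chosen. For complex-linear operators the real inner
  product determines the same adjoint as the complex one.\<close>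

definition adjoint_pair :: "('a::real_inner \<Rightarrow>\<^sub>L 'a) \<Rightarrow> ('a \<Rightarrow>\<^sub>L 'a) \<Rightarrow> bool" where
  "adjoint_pair T S \<longleftrightarrow> (\<forall>x y. inner (T x) y = inner x (S y))"

lemma linear_scaleC_iff: "Vector_Spaces.linear scaleC scaleC (blinfun_apply T) \<longleftrightarrow> clinear T"
proof
  assume "Vector_Spaces.linear scaleC scaleC (blinfun_apply T)"
  then interpret Vector_Spaces.linear scaleC scaleC "blinfun_apply T" .
  show "clinear T" by (simp add: clinear_def scale)
next
  assume "clinear T"
  then show "Vector_Spaces.linear scaleC scaleC (blinfun_apply T)"
    by unfold_locales (simp_all add: clinear_def blinfun.add_right)
qed

lemma clinearD: "clinear T \<Longrightarrow> T (c *\<^sub>C x) = c *\<^sub>C T x"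
  by (simp add: clinear_def)

lemma adjoint_pairD: "adjoint_pair T S \<Longrightarrow> inner (T x) y = inner x (S y)"
  by (simp add: adjoint_pair_def)

lemma adjoint_pair_sym: "adjoint_pair T S \<Longrightarrow> adjoint_pair S T"
  by (metis adjoint_pair_def inner_commute)

lemma blinfun_eq_inner:
  fixes S T :: "'a::real_normed_vector \<Rightarrow>\<^sub>L 'b::real_inner"
  assumes "\<And>x y. inner (S x) y = inner (T x) y"
  shows "S = T"
proof (rule blinfun_eqI)
  fix x
  have "inner (S x - T x) (S x - T x) = 0" using assms by (simp add: inner_diff_left)
  then show "S x = T x" by simp
qed

lemma adjoint_pair_compose:
  "adjoint_pair S S' \<Longrightarrow> adjoint_pair T T' \<Longrightarrow> adjoint_pair (S o\<^sub>L T) (T' o\<^sub>L S')"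
  by (simp add: adjoint_pair_def)

lemma adjoint_pair_unique: "adjoint_pair T S \<Longrightarrow> adjoint_pair T S' \<Longrightarrow> S = S'"
  by (rule blinfun_eq_inner) (metis adjoint_pair_def inner_commute)

lemma scaleC_scaleR_commute: "c *\<^sub>C r *\<^sub>R x = r *\<^sub>R c *\<^sub>C (x :: 'a::complex_vector)"
  by (simp add: scaleR_scaleC scaleC_scaleC mult.commute)

lemma inner_scaleC_left: "inner (c *\<^sub>C x) y = inner x (cnj c *\<^sub>C (y :: 'a::complex_hilbert))"
  by (simp add: inner_eq_Re_cinner cinner_scaleC_left cinner_scaleC_right)

lemma cinner_eq_0_iff:
  "cinner x y = 0 \<longleftrightarrow> inner x y = 0 \<and> inner x (\<i> *\<^sub>C (y :: 'a::complex_hilbert)) = 0"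
  by (simp add: inner_eq_Re_cinner cinner_scaleC_right complex_eq_iff)

lemma cinner_diff_left: "cinner (x - y) z = cinner x z - cinner y (z :: 'a::complex_hilbert)"
  using cinner_add_left[of "x - y" y z] by simp

text \<open>The Riesz representation of \<open>x\<close> mapped to \<open>cinner (T x) z\<close>,
  for each \<open>z\<close>, gives the value of the adjoint at \<open>z\<close>.\<close>

lemma adjoint_pair_ex:
  fixes T :: "'a::complex_hilbert \<Rightarrow>\<^sub>L 'a"
  assumes T: "clinear T"
  shows "\<exists>S. clinear S \<and> adjoint_pair T S"
proof -
  have "\<exists>w. \<forall>x. inner (T x) z = inner x w" for z
  proof -
    let ?f = "\<lambda>x. cinner (T x) z"
    let ?K = "{x. ?f x = 0}"
    have f_diff: "?f (x - y) = ?f x - ?f y" for x y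
      by (simp add: blinfun.diff_right cinner_diff_left)
    have f_scale: "?f (c *\<^sub>C x) = c * ?f x" for c x
      by (simp add: clinearD[OF T] cinner_scaleC_left)
    have closed: "closed ?K"
      unfolding cinner_eq_0_iff
      by (intro closed_Collect_conj closed_Collect_eq continuous_intros)
    have "?f (x + y) = ?f x + ?f y" for x y
      by (simp add: blinfun.add_right cinner_add_left)
    moreover have "?f 0 = 0" using f_diff[of 0 0] by simp
    ultimately have sub: "csubspace ?K"
      by (simp add: complex_vector.subspace_def f_scale)
    show ?thesis
    proof (cases "?K = UNIV")
      case True
      then have "cinner (T x) z = 0" for x by auto
      then have "inner (T x) z = inner x 0" for x by (simp add: cinner_eq_0_iff)
      then show ?thesis by blast
    next
      case False
      then obtain x0 where x0: "?f x0 \<noteq> 0" by auto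
      define v where "v = x0 - orth_proj ?K x0"
      have fv: "?f v \<noteq> 0"
        using orth_proj(1)[OF closed sub, of x0] x0 by (simp add: v_def f_diff)
      have vK: "cinner v y = 0" if "?f y = 0" for y
        using orth_proj(2)[OF closed sub, of y x0] that by (simp add: v_def)
      have vv: "cinner v v \<noteq> 0" using vK fv
        by (metis cinner_self norm_eq_zero of_real_eq_0_iff power_eq_0_iff blinfun.zero_right zero_power2 cinner_scaleC_left complex_vector.scale_zero_left mult_zero_left)
      \<comment> \<open>The scalar makes \<open>cinner v w = ?f v\<close>. Both functionals vanish
        on the kernel \<open>?K\<close>, which together with \<open>v\<close> spans the
        space.\<close>
      define w where "w = cnj (?f v / cinner v v) *\<^sub>C v"
      have "?f x = cinner x w" for x
      proof -
        have "?f (x - (?f x / ?f v) *\<^sub>C v) = 0" using fv by (simp add: f_diff f_scale)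
        then have "cinner (x - (?f x / ?f v) *\<^sub>C v) v = 0"
          using vK cinner_commute by (metis complex_cnj_zero)
        then have "cinner x v = ?f x / ?f v * cinner v v"
          by (simp add: cinner_diff_left cinner_scaleC_left)
        then show ?thesis using fv vv by (simp add: w_def cinner_scaleC_right field_simps)
      qed
      then have "inner (T x) z = inner x w" for x by (simp add: inner_eq_Re_cinner)
      then show ?thesis by blast
    qed
  qed
  then obtain S where S: "\<And>x z. inner (T x) z = inner x (S z)" by metis
  have eqI: "u = v" if "\<And>x. inner x u = inner x v" for u v :: 'a
    using that[of "u - v"] by (metis eq_iff_diff_eq_0 inner_diff_right inner_eq_zero_iff)
  have bl: "bounded_linear S"
  proof (rule bounded_linear_intro[where K = "norm T"])
    show "S (x + y) = S x + S y" for x y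
      by (rule eqI) (simp add: S[symmetric] inner_add_right)
    show "S (r *\<^sub>R x) = r *\<^sub>R S x" for r x
      by (rule eqI) (simp add: S[symmetric])
    show "norm (S x) \<le> norm x * norm T" for x
    proof (cases "S x = 0")
      case False
      have "norm (S x) * norm (S x) = inner (T (S x)) x" by (simp add: S norm_eq_sqrt_inner)
      also have "\<dots> \<le> norm (T (S x)) * norm x" by (rule norm_cauchy_schwarz)
      also have "\<dots> \<le> norm T * norm (S x) * norm x"
        by (intro mult_right_mono norm_blinfun) simp
      finally show ?thesis using False by (simp add: mult_ac)
    qed simp
  qed
  have "S (c *\<^sub>C x) = c *\<^sub>C S x" for c x
  proof (rule eqI)
    fix y
    have "inner y (S (c *\<^sub>C x)) = inner (T (cnj c *\<^sub>C y)) x"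
      by (simp add: S[symmetric] clinearD[OF T] inner_scaleC_left)
    also have "\<dots> = inner y (c *\<^sub>C S x)" by (simp add: S inner_scaleC_left)
    finally show "inner y (S (c *\<^sub>C x)) = inner y (c *\<^sub>C S x)" .
  qed
  then have "clinear (Blinfun S)" "adjoint_pair T (Blinfun S)"
    using S by (simp_all add: clinear_def adjoint_pair_def bounded_linear_Blinfun_apply[OF bl])
  then show ?thesis by blast
qed

section \<open>Orthogonal projections as bounded operators\<close>

definition proj_op :: "'a::complex_hilbert set \<Rightarrow> 'a \<Rightarrow>\<^sub>L 'a" where
  "proj_op K = Blinfun (orth_proj K)"

context
  fixes K :: "'a::complex_hilbert set"
  assumes K: "closed K" "csubspace K"
begin

lemma orth_proj_eqI:
  assumes "y \<in> K" "\<And>z. z \<in> K \<Longrightarrow> inner (x - y) z = 0"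
  shows "orth_proj K x = y"
proof -
  let ?q = "orth_proj K x"
  have q: "y - ?q \<in> K" using assms(1) orth_proj(1)[OF K] K(2) complex_vector.subspace_diff by blast
  have "inner (y - ?q) (y - ?q) = inner (x - ?q) (y - ?q) - inner (x - y) (y - ?q)"
    by (simp add: inner_diff_left)
  also have "\<dots> = 0" using assms(2)[OF q] orth_proj(2)[OF K q] by (simp add: inner_eq_Re_cinner)
  finally show ?thesis by simp
qed

lemma inner_orth_proj: "z \<in> K \<Longrightarrow> inner (x - orth_proj K x) z = 0"
  using orth_proj(2)[OF K] by (simp add: inner_eq_Re_cinner)

lemma bounded_linear_orth_proj: "bounded_linear (orth_proj K)"
proof (rule bounded_linear_intro[where K = 1])
  note mem = orth_proj(1)[OF K]
  note sub = csubspace_imp_subspace[OF K(2)]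
  show "orth_proj K (x + y) = orth_proj K x + orth_proj K y" for x y
    using inner_orth_proj by (intro orth_proj_eqI subspace_add[OF sub] mem)
      (simp add: add_diff_add inner_add_left)
  show "orth_proj K (r *\<^sub>R x) = r *\<^sub>R orth_proj K x" for r x
    using inner_orth_proj by (intro orth_proj_eqI subspace_scale[OF sub] mem)
      (simp add: scaleR_diff_right[symmetric])
  show "norm (orth_proj K x) \<le> norm x * 1" for x
  proof (cases "orth_proj K x = 0")
    case False
    have "inner x (orth_proj K x) = inner (orth_proj K x) (orth_proj K x)"
      using inner_orth_proj[OF mem, of x x] by (simp add: inner_diff_left)
    then have "norm (orth_proj K x) * norm (orth_proj K x) \<le> norm x * norm (orth_proj K x)"
      using norm_cauchy_schwarz[of x "orth_proj K x"] by (simp add: dot_square_norm power2_eq_square)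
    then show ?thesis using False by simp
  qed simp
qed

lemma proj_op_apply: "proj_op K x = orth_proj K x"
  by (simp add: proj_op_def bounded_linear_Blinfun_apply bounded_linear_orth_proj)

lemma proj_op_in: "proj_op K x \<in> K"
  by (simp add: proj_op_apply orth_proj(1)[OF K])

lemma proj_op_eq_iff: "proj_op K x = x \<longleftrightarrow> x \<in> K"
  using proj_op_in[of x] orth_proj_eqI[of x x] by (auto simp: proj_op_apply)

lemma clinear_proj_op: "clinear (proj_op K)"
  unfolding clinear_def
proof (intro allI)
  fix c x
  have "c *\<^sub>C orth_proj K x \<in> K"
    using K(2) orth_proj(1)[OF K] by (simp add: complex_vector.subspace_scale)
  moreover have "cnj c *\<^sub>C z \<in> K" if "z \<in> K" for z
    using K(2) that by (simp add: complex_vector.subspace_scale)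
  ultimately show "proj_op K (c *\<^sub>C x) = c *\<^sub>C proj_op K x"
    using inner_orth_proj unfolding proj_op_apply
    by (intro orth_proj_eqI) (simp_all add: complex_vector.scale_right_diff_distrib[symmetric] inner_scaleC_left)
qed

lemma proj_op_idem: "proj_op K o\<^sub>L proj_op K = proj_op K"
  by (rule blinfun_eqI) (simp add: proj_op_eq_iff proj_op_in)

lemma proj_op_selfadjoint: "adjoint_pair (proj_op K) (proj_op K)"
  unfolding adjoint_pair_def
proof (intro allI)
  fix x y
  have "inner (proj_op K x) (y - proj_op K y) = 0" "inner (x - proj_op K x) (proj_op K y) = 0"
    using inner_orth_proj[OF proj_op_in] by (simp_all add: proj_op_apply inner_commute)
  then show "inner (proj_op K x) y = inner x (proj_op K y)"
    by (simp add: inner_diff_left inner_diff_right)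
qed

lemma proj_op_invariant_iff:
  "proj_op K o\<^sub>L T o\<^sub>L proj_op K = T o\<^sub>L proj_op K \<longleftrightarrow> blinfun_apply T ` K \<subseteq> K"
proof
  assume *: "proj_op K o\<^sub>L T o\<^sub>L proj_op K = T o\<^sub>L proj_op K"
  show "blinfun_apply T ` K \<subseteq> K"
  proof (rule image_subsetI)
    fix x assume "x \<in> K"
    then show "T x \<in> K" using proj_op_eq_iff arg_cong[OF *, of "\<lambda>S. blinfun_apply S x"]
      by (metis blinfun_apply_blinfun_compose)
  qed
next
  assume "blinfun_apply T ` K \<subseteq> K"
  then show "proj_op K o\<^sub>L T o\<^sub>L proj_op K = T o\<^sub>L proj_op K"
    using proj_op_in by (intro blinfun_eqI) (simp add: proj_op_eq_iff image_subset_iff)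
qed

text \<open>Invariance means \<open>P T P = T P\<close>. The left side is self-adjoint, so
  \<open>T P\<close> coincides with its adjoint \<open>P T\<close>.\<close>

lemma proj_op_commute:
  assumes T: "adjoint_pair T T" and inv: "blinfun_apply T ` K \<subseteq> K"
  shows "T o\<^sub>L proj_op K = proj_op K o\<^sub>L T"
proof (rule adjoint_pair_unique)
  have "adjoint_pair (proj_op K o\<^sub>L T o\<^sub>L proj_op K) (proj_op K o\<^sub>L (T o\<^sub>L proj_op K))"
    by (intro adjoint_pair_compose proj_op_selfadjoint T)
  moreover have inv': "proj_op K o\<^sub>L T o\<^sub>L proj_op K = T o\<^sub>L proj_op K"
    using inv by (simp add: proj_op_invariant_iff)
  moreover have "proj_op K o\<^sub>L (T o\<^sub>L proj_op K) = proj_op K o\<^sub>L T o\<^sub>L proj_op K"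
    by (rule blinfun_eqI) simp
  ultimately show "adjoint_pair (T o\<^sub>L proj_op K) (T o\<^sub>L proj_op K)" by simp
  show "adjoint_pair (T o\<^sub>L proj_op K) (proj_op K o\<^sub>L T)"
    by (intro adjoint_pair_compose proj_op_selfadjoint T)
qed

end

section \<open>Approximation of self-adjoint operators by projections\<close>

instance complex_hilbert \<subseteq> banach ..

lemmas compose_distrib =
  bounded_bilinear.add_left[OF bounded_bilinear_blinfun_compose]
  bounded_bilinear.add_right[OF bounded_bilinear_blinfun_compose]
  bounded_bilinear.diff_left[OF bounded_bilinear_blinfun_compose]
  bounded_bilinear.diff_right[OF bounded_bilinear_blinfun_compose]
  bounded_bilinear.scaleR_left[OF bounded_bilinear_blinfun_compose]
  bounded_bilinear.scaleR_right[OF bounded_bilinear_blinfun_compose]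

lemma compose_assoc: "a o\<^sub>L b o\<^sub>L c = a o\<^sub>L (b o\<^sub>L c)"
  by (rule blinfun_eqI) simp

lemma compose_id [simp]: "a o\<^sub>L id_blinfun = a" "id_blinfun o\<^sub>L a = a"
  by (rule blinfun_eqI; simp)+

lemma clinear_intros:
  "clinear 0" "clinear id_blinfun"
  "clinear S \<Longrightarrow> clinear T \<Longrightarrow> clinear (S + T)"
  "clinear S \<Longrightarrow> clinear T \<Longrightarrow> clinear (S - T)"
  "clinear S \<Longrightarrow> clinear T \<Longrightarrow> clinear (S o\<^sub>L T)"
  "clinear S \<Longrightarrow> clinear (r *\<^sub>R S)"
  "clinear S \<Longrightarrow> clinear (c *\<^sub>C S)"
  by (simp_all add: clinear_def blinfun.bilinear_simps complex_vector.scale_right_diff_distrib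
      scaleC_add_right scaleC_scaleR_commute scaleC_blinfun.rep_eq scaleC_scaleC mult.commute)

lemma selfadjoint_intros:
  "adjoint_pair 0 0" "adjoint_pair id_blinfun id_blinfun"
  "adjoint_pair S S' \<Longrightarrow> adjoint_pair T T' \<Longrightarrow> adjoint_pair (S + T) (S' + T')"
  "adjoint_pair S S' \<Longrightarrow> adjoint_pair T T' \<Longrightarrow> adjoint_pair (S - T) (S' - T')"
  "adjoint_pair S S' \<Longrightarrow> adjoint_pair (r *\<^sub>R S) (r *\<^sub>R S')"
  by (simp_all add: adjoint_pair_def blinfun.bilinear_simps inner_add_left inner_add_right
      inner_diff_left inner_diff_right)

lemma closed_clinear: "closed {T :: 'a::complex_hilbert \<Rightarrow>\<^sub>L 'a. clinear T}"
  unfolding clinear_def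
  by (intro closed_Collect_all closed_Collect_eq continuous_intros
      bounded_linear.continuous_on[OF bounded_linear_scaleC_right])

lemma closed_selfadjoint: "closed {T :: 'a::real_inner \<Rightarrow>\<^sub>L 'a. adjoint_pair T T}"
  unfolding adjoint_pair_def
  by (intro closed_Collect_all closed_Collect_eq continuous_intros)

lemma closed_commutant: "closed {T. \<forall>S. Q S \<longrightarrow> S o\<^sub>L T = T o\<^sub>L S}"
  by (intro closed_Collect_all closed_Collect_imp open_Collect_const closed_Collect_eq continuous_intros)

text \<open>
  The fixed point \<open>y = (b + y\<^sup>2) / 2\<close> satisfies \<open>(1 - y)\<^sup>2 = 1 - b\<close>. The iteration converges in norm because
  its increments are dominated by those of the scalar iteration at \<open>b = 1\<close>, which increases to \<open>1\<close>.
\<close>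

fun sqrt_majorant :: "nat \<Rightarrow> real" where
  "sqrt_majorant 0 = 0"
| "sqrt_majorant (Suc n) = (1 + (sqrt_majorant n)\<^sup>2) / 2"

lemma sqrt_majorant_bounds: "0 \<le> sqrt_majorant n" "sqrt_majorant n \<le> 1"
proof (induction n)
  case (Suc n)
  case 1 show ?case by simp
  case 2 show ?case using Suc by (simp add: power_le_one)
qed auto

lemma sqrt_majorant_mono: "incseq sqrt_majorant"
proof (rule incseq_SucI)
  fix n
  have "0 \<le> (1 - sqrt_majorant n)\<^sup>2" by simp
  then show "sqrt_majorant n \<le> sqrt_majorant (Suc n)"
    by (simp add: power2_eq_square algebra_simps)
qed

fun sqrt_iterate :: "('a::real_normed_vector \<Rightarrow>\<^sub>L 'a) \<Rightarrow> nat \<Rightarrow> ('a \<Rightarrow>\<^sub>L 'a)" where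
  "sqrt_iterate b 0 = 0"
| "sqrt_iterate b (Suc n) = (1/2) *\<^sub>R (b + (sqrt_iterate b n o\<^sub>L sqrt_iterate b n))"

lemma sqrt_iterate_commute:
  assumes "S o\<^sub>L b = b o\<^sub>L S"
  shows "S o\<^sub>L sqrt_iterate b n = sqrt_iterate b n o\<^sub>L S"
proof (induction n)
  case (Suc n)
  let ?y = "sqrt_iterate b n"
  have "S o\<^sub>L (?y o\<^sub>L ?y) = ?y o\<^sub>L ?y o\<^sub>L S"
    using Suc by (metis compose_assoc)
  then show ?case using assms by (simp add: compose_distrib)
qed simp

lemma norm_sqrt_iterate:
  assumes "norm b \<le> 1"
  shows "norm (sqrt_iterate b n) \<le> sqrt_majorant n"
proof (induction n)
  case (Suc n)
  let ?y = "sqrt_iterate b n"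
  have "norm (?y o\<^sub>L ?y) \<le> norm ?y * norm ?y" by (rule norm_blinfun_compose)
  also have "\<dots> \<le> (sqrt_majorant n)\<^sup>2"
    using Suc sqrt_majorant_bounds(1)[of n] by (simp add: power2_eq_square mult_mono)
  finally have "norm (b + (?y o\<^sub>L ?y)) \<le> 1 + (sqrt_majorant n)\<^sup>2"
    using assms norm_triangle_ineq[of b "?y o\<^sub>L ?y"] by linarith
  then show ?case by simp
qed simp

text \<open>Successive iterates commute, so the difference of their squares factors as
  \<open>(?z - ?y) (?z + ?y)\<close>; the scalar iteration factors in the same way and dominates
  each factor.\<close>

lemma norm_sqrt_iterate_step:
  assumes "norm b \<le> 1"
  shows "norm (sqrt_iterate b (Suc n) - sqrt_iterate b n) \<le> sqrt_majorant (Suc n) - sqrt_majorant n"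
proof (induction n)
  case 0
  then show ?case using assms by simp
next
  case (Suc n)
  let ?y = "sqrt_iterate b n" and ?z = "sqrt_iterate b (Suc n)"
  have "?y o\<^sub>L b = b o\<^sub>L ?y" using sqrt_iterate_commute[of b b n] by simp
  then have comm: "?y o\<^sub>L ?z = ?z o\<^sub>L ?y" by (rule sqrt_iterate_commute)
  have "sqrt_iterate b (Suc (Suc n)) - ?z = (1/2) *\<^sub>R ((?z o\<^sub>L ?z) - (?y o\<^sub>L ?y))"
    by (subst (1 2) sqrt_iterate.simps(2)) (simp add: scaleR_diff_right[symmetric] del: sqrt_iterate.simps)
  also have "(?z o\<^sub>L ?z) - (?y o\<^sub>L ?y) = (?z - ?y) o\<^sub>L (?z + ?y)"
    using comm by (simp add: compose_distrib del: sqrt_iterate.simps)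
  finally have "norm (sqrt_iterate b (Suc (Suc n)) - ?z) = norm ((?z - ?y) o\<^sub>L (?z + ?y)) / 2"
    by simp
  also have "\<dots> \<le> (norm (?z - ?y) * norm (?z + ?y)) / 2"
    by (intro divide_right_mono norm_blinfun_compose) simp
  also have "\<dots> \<le> ((sqrt_majorant (Suc n) - sqrt_majorant n) * (sqrt_majorant (Suc n) + sqrt_majorant n)) / 2"
  proof (intro divide_right_mono mult_mono Suc)
    show "norm (?z + ?y) \<le> sqrt_majorant (Suc n) + sqrt_majorant n"
      using norm_triangle_mono norm_sqrt_iterate[OF assms] by blast
    show "0 \<le> sqrt_majorant (Suc n) - sqrt_majorant n"
      using Suc norm_ge_zero order_trans by blast
  qed simp_all
  also have "\<dots> = sqrt_majorant (Suc (Suc n)) - sqrt_majorant (Suc n)"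
    by (simp add: power2_eq_square field_simps)
  finally show ?case .
qed

lemma Cauchy_sqrt_iterate:
  assumes "norm b \<le> 1"
  shows "Cauchy (sqrt_iterate b)"
proof -
  have step: "norm (sqrt_iterate b (n + k) - sqrt_iterate b n) \<le> sqrt_majorant (n + k) - sqrt_majorant n" for n k
  proof (induction k)
    case (Suc k)
    have "sqrt_iterate b (n + Suc k) - sqrt_iterate b n =
        (sqrt_iterate b (Suc (n + k)) - sqrt_iterate b (n + k)) + (sqrt_iterate b (n + k) - sqrt_iterate b n)"
      by (simp del: sqrt_iterate.simps)
    also have "norm \<dots> \<le> (sqrt_majorant (Suc (n + k)) - sqrt_majorant (n + k)) + (sqrt_majorant (n + k) - sqrt_majorant n)"
      by (intro norm_triangle_mono norm_sqrt_iterate_step assms Suc)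
    finally show ?case by (simp del: sqrt_majorant.simps)
  qed simp
  obtain l where "sqrt_majorant \<longlonglongrightarrow> l"
    using incseq_convergent[OF sqrt_majorant_mono, of 1] sqrt_majorant_bounds(2) by metis
  then have "convergent sqrt_majorant" by (rule convergentI)
  then have Cauchy: "Cauchy sqrt_majorant" by (rule convergent_Cauchy)
  have le: "dist (sqrt_iterate b n) (sqrt_iterate b m) \<le> dist (sqrt_majorant n) (sqrt_majorant m)"
    if "n \<le> m" for m n
    using step[of n "m - n"] that by (simp add: dist_norm norm_minus_commute)
  have "dist (sqrt_iterate b m) (sqrt_iterate b n) \<le> dist (sqrt_majorant m) (sqrt_majorant n)" for m n
    using le[of m n] le[of n m] by (cases "m \<le> n") (simp_all add: dist_commute)
  then show ?thesis
    using Cauchy unfolding Cauchy_def by (meson le_less_trans)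
qed

lemma norm_blinfun_bound_power2:
  fixes T :: "'a::real_normed_vector \<Rightarrow>\<^sub>L 'b::real_normed_vector"
  assumes "\<And>x. (norm (T x))\<^sup>2 \<le> c\<^sup>2 * (norm x)\<^sup>2" "0 \<le> c"
  shows "norm T \<le> c"
proof (rule norm_blinfun_bound[OF assms(2)])
  fix x
  have "(norm (T x))\<^sup>2 \<le> (c * norm x)\<^sup>2" using assms(1) by (simp add: power_mult_distrib)
  then show "norm (T x) \<le> c * norm x" using assms(2) power2_le_imp_le by (metis mult_nonneg_nonneg norm_ge_zero)
qed

text \<open>Take \<open>r = 1 - y\<close> with \<open>y\<close> the limit of the iteration for
  \<open>b = 1 - a a\<close>. The inequality, \<open>r r \<le> r\<close>, is the form in which
  \<open>0 \<le> r \<le> 1\<close> is used later.\<close>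

lemma absolute_value_ex:
  fixes a :: "'a::complex_hilbert \<Rightarrow>\<^sub>L 'a"
  assumes cl: "clinear a" and sa: "adjoint_pair a a" and norm: "norm a \<le> 1"
  shows "\<exists>r. clinear r \<and> adjoint_pair r r \<and> r o\<^sub>L r = a o\<^sub>L a \<and>
    (\<forall>x. inner (r (r x)) x \<le> inner (r x) x) \<and>
    (\<forall>S. S o\<^sub>L a = a o\<^sub>L S \<longrightarrow> S o\<^sub>L r = r o\<^sub>L S)"
proof -
  define b where "b = id_blinfun - (a o\<^sub>L a)"
  have na: "norm (a x) \<le> norm x" for x
    using norm_blinfun[of a x] norm mult_right_mono[of "norm a" 1 "norm x"] by simp
  have aa: "inner (a (a x)) x = (norm (a x))\<^sup>2" for x
    using sa by (simp add: adjoint_pair_def power2_norm_eq_inner)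
  have b_pos: "0 \<le> inner (b x) x" for x
    using na[of x] by (simp add: b_def blinfun.diff_left inner_diff_left aa dot_square_norm)
  have norm_b: "norm b \<le> 1"
  proof (rule norm_blinfun_bound_power2)
    fix x
    have "(norm (b x))\<^sup>2 = (norm x)\<^sup>2 - 2 * (norm (a x))\<^sup>2 + (norm (a (a x)))\<^sup>2"
      using aa[of x]
      by (simp add: b_def blinfun.diff_left power2_norm_eq_inner inner_diff_left inner_diff_right inner_commute)
    also have "\<dots> \<le> (norm x)\<^sup>2"
    proof -
      have "(norm (a (a x)))\<^sup>2 \<le> (norm (a x))\<^sup>2" by (rule power_mono[OF na]) simp
      then show ?thesis using zero_le_power2[of "norm (a x)"] by linarith
    qed
    finally show "(norm (b x))\<^sup>2 \<le> 1\<^sup>2 * (norm x)\<^sup>2" by simp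
  qed simp
  have commb: "S o\<^sub>L b = b o\<^sub>L S" if "S o\<^sub>L a = a o\<^sub>L S" for S
  proof -
    have "S o\<^sub>L (a o\<^sub>L a) = a o\<^sub>L a o\<^sub>L S" using that by (metis compose_assoc)
    then show ?thesis by (simp add: b_def compose_distrib)
  qed
  obtain y where lim: "sqrt_iterate b \<longlonglongrightarrow> y"
    using Cauchy_convergent[OF Cauchy_sqrt_iterate[OF norm_b]] by (auto simp: convergent_def)
  have clb: "clinear b" unfolding b_def by (intro clinear_intros cl)
  have sab: "adjoint_pair b b" unfolding b_def by (intro selfadjoint_intros adjoint_pair_compose sa)
  have "clinear (sqrt_iterate b n)" for n
    by (induction n) (auto intro!: clinear_intros clb)
  then have cly: "clinear y"
    using closed_sequentially[OF closed_clinear _ lim] by simp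
  have "adjoint_pair (sqrt_iterate b n) (sqrt_iterate b n)" for n
    by (induction n) (auto intro!: selfadjoint_intros adjoint_pair_compose sab)
  then have say: "adjoint_pair y y"
    using closed_sequentially[OF closed_selfadjoint _ lim] by simp
  have commy: "S o\<^sub>L y = y o\<^sub>L S" if "S o\<^sub>L a = a o\<^sub>L S" for S
    using closed_sequentially[OF closed_commutant[of "\<lambda>S. S o\<^sub>L a = a o\<^sub>L S"] _ lim]
      sqrt_iterate_commute[OF commb] that by blast
  have "(\<lambda>n. sqrt_iterate b (Suc n)) \<longlonglongrightarrow> (1/2) *\<^sub>R (b + (y o\<^sub>L y))"
    unfolding sqrt_iterate.simps by (intro tendsto_intros lim bounded_bilinear.tendsto[OF bounded_bilinear_blinfun_compose])
  then have y_eq: "y = (1/2) *\<^sub>R (b + (y o\<^sub>L y))"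
    using LIMSEQ_unique LIMSEQ_Suc[OF lim] by blast
  then have "2 *\<^sub>R y = 2 *\<^sub>R (1/2) *\<^sub>R (b + (y o\<^sub>L y))" by (rule arg_cong)
  then have yy: "y o\<^sub>L y = 2 *\<^sub>R y - b" by (simp add: algebra_simps)
  have norm_y: "norm y \<le> 1"
    by (rule LIMSEQ_le_const2[OF tendsto_norm[OF lim]])
      (use norm_sqrt_iterate[OF norm_b] sqrt_majorant_bounds(2) order_trans in blast)
  have y_le: "inner (y x) x \<le> inner x x" for x
  proof -
    have "inner (y x) x \<le> norm (y x) * norm x" by (rule norm_cauchy_schwarz)
    also have "\<dots> \<le> (norm y * norm x) * norm x" by (intro mult_right_mono norm_blinfun) simp
    also have "\<dots> \<le> (1 * norm x) * norm x" by (intro mult_right_mono norm_y) simp_all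
    finally show ?thesis by (simp add: dot_square_norm power2_eq_square)
  qed
  have y_pos: "0 \<le> inner (y x) x" for x
  proof -
    have "y x = (1/2) *\<^sub>R (b x + y (y x))"
      using arg_cong[OF y_eq, of "\<lambda>T. blinfun_apply T x"] by (simp add: blinfun.bilinear_simps)
    then have "inner (y x) x = (inner (b x) x + inner (y (y x)) x) / 2"
      by (metis inner_add_left inner_scaleR_left mult.commute times_divide_eq_right mult_1_right)
    also have "inner (y (y x)) x = inner (y x) (y x)" using say by (simp add: adjoint_pair_def)
    finally show ?thesis using add_nonneg_nonneg[OF b_pos[of x] inner_ge_zero[of "y x"]] by simp
  qed
  define r where "r = id_blinfun - y"
  have sar: "adjoint_pair r r" unfolding r_def by (intro selfadjoint_intros say)
  have rr: "r o\<^sub>L r = a o\<^sub>L a"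
    by (simp add: r_def compose_distrib yy b_def scaleR_2)
  have commr: "S o\<^sub>L r = r o\<^sub>L S" if "S o\<^sub>L a = a o\<^sub>L S" for S
    using commy[OF that] by (simp add: r_def compose_distrib)
  have "inner (r (r x)) x \<le> inner (r x) x" for x
  proof -
    \<comment> \<open>Since \<open>r + y = 1\<close> and both commute,
      \<open>r - r r = r y = r y r + y r y\<close>; both summands are positive because
      \<open>0 \<le> y \<le> 1\<close>.\<close>
    have "r x - r (r x) = r (y (r x)) + y (r (y x))"
      by (simp add: r_def blinfun.bilinear_simps)
    then have "inner (r x) x - inner (r (r x)) x = inner (y (r x)) (r x) + inner (r (y x)) (y x)"
      by (metis inner_diff_left inner_add_left adjoint_pairD[OF sar] adjoint_pairD[OF say])
    moreover have "0 \<le> inner (r (y x)) (y x)"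
      using y_le[of "y x"] by (simp add: r_def blinfun.diff_left inner_diff_left)
    ultimately show ?thesis using y_pos[of "r x"] by linarith
  qed
  then show ?thesis
    using sar rr commr clinear_intros(4)[OF clinear_intros(2) cly] unfolding r_def[symmetric] by blast
qed

text \<open>
  With \<open>r = \<bar>a\<bar>\<close> and \<open>e\<close> the projection onto the kernel of \<open>r - a\<close>, the symmetry \<open>s = 2 e - 1\<close> gives
  \<open>a = r s\<close>, so \<open>a - s / 2 = (r - 1/2) s\<close>, and \<open>0 \<le> r \<le> 1\<close>.
\<close>

lemma spectral_step:
  fixes a :: "'a::complex_hilbert \<Rightarrow>\<^sub>L 'a"
  assumes cl: "clinear a" and sa: "adjoint_pair a a" and norm: "norm a \<le> 1"
  shows "\<exists>e. clinear e \<and> adjoint_pair e e \<and> e o\<^sub>L e = e \<and>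
    (\<forall>S. adjoint_pair S S \<and> S o\<^sub>L a = a o\<^sub>L S \<longrightarrow> S o\<^sub>L e = e o\<^sub>L S) \<and>
    norm (a - (e - (1/2) *\<^sub>R id_blinfun)) \<le> 1/2"
proof -
  obtain r where r: "clinear r" "adjoint_pair r r" "r o\<^sub>L r = a o\<^sub>L a"
    "\<And>x. inner (r (r x)) x \<le> inner (r x) x" "\<And>S. S o\<^sub>L a = a o\<^sub>L S \<Longrightarrow> S o\<^sub>L r = r o\<^sub>L S"
    using absolute_value_ex[OF assms] by blast
  define K where "K = {x. r x = a x}"
  have clK: "closed K" unfolding K_def by (intro closed_Collect_eq continuous_intros)
  have subK: "csubspace K"
    by (simp add: K_def complex_vector.subspace_def blinfun.bilinear_simps clinearD[OF cl] clinearD[OF r(1)])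
  note K = clK subK
  define e where "e = proj_op K"
  have sae: "adjoint_pair e e" unfolding e_def by (rule proj_op_selfadjoint[OF K])
  have ee: "e (e x) = e x" for x
    using arg_cong[OF proj_op_idem[OF K], of "\<lambda>T. blinfun_apply T x"] by (simp add: e_def)
  have comm: "S o\<^sub>L e = e o\<^sub>L S" if S: "adjoint_pair S S" "S o\<^sub>L a = a o\<^sub>L S" for S
    unfolding e_def
  proof (rule proj_op_commute[OF K S(1)], rule image_subsetI)
    fix x assume "x \<in> K"
    then have "S (r x) = S (a x)" by (simp add: K_def)
    moreover have "S (r x) = r (S x)" "S (a x) = a (S x)"
      using arg_cong[OF r(5)[OF S(2)], of "\<lambda>T. blinfun_apply T x"]
        arg_cong[OF S(2), of "\<lambda>T. blinfun_apply T x"] by simp_all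
    ultimately have "r (S x) = a (S x)" by simp
    then show "S x \<in> K" by (simp add: K_def)
  qed
  have ra: "r o\<^sub>L a = a o\<^sub>L r" using r(5)[of a] by simp
  have on_K: "r (e x) = a (e x)" for x
    using proj_op_in[OF K, of x] by (simp add: e_def K_def)
  \<comment> \<open>From \<open>r r = a a\<close> and \<open>r a = a r\<close> the range of
    \<open>r + a\<close> lies in \<open>K\<close>; being self-adjoint, \<open>r + a\<close> vanishes
    on the orthogonal complement of \<open>K\<close>.\<close>
  have off_K: "r (x - e x) = - a (x - e x)" for x
  proof -
    let ?x = "x - e x"
    have "r (r z + a z) = a (r z + a z)" for z
      using arg_cong[OF ra, of "\<lambda>T. blinfun_apply T z"] arg_cong[OF r(3), of "\<lambda>T. blinfun_apply T z"]
      by (simp add: blinfun.add_right)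
    then have "r z + a z \<in> K" for z by (simp add: K_def)
    then have "e (r z + a z) = r z + a z" for z
      unfolding e_def by (simp only: proj_op_eq_iff[OF K])
    then have "inner (r ?x + a ?x) z = inner ?x (e (r z + a z))" for z
      by (simp add: inner_add_left inner_add_right adjoint_pairD[OF r(2)] adjoint_pairD[OF sa])
    also have "\<dots> z = inner (e ?x) (r z + a z)" for z by (simp add: adjoint_pairD[OF sae])
    also have "\<dots> z = 0" for z by (simp add: blinfun.diff_right ee)
    finally have "inner (r ?x + a ?x) (r ?x + a ?x) = 0" by blast
    then show ?thesis by (simp add: add_eq_0_iff)
  qed
  have "norm (a - (e - (1/2) *\<^sub>R id_blinfun)) \<le> 1/2"
  proof (rule norm_blinfun_bound_power2)
    fix x
    define s where "s = e x - (x - e x)"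
    have "a x = a (e x) + a (x - e x)" by (simp add: blinfun.diff_right)
    also have "\<dots> = r s" using on_K[of x] off_K[of x] unfolding s_def by (simp only: blinfun.diff_right) simp
    finally have as: "a x = r s" .
    have "s = 2 *\<^sub>R e x - x" by (simp add: s_def scaleR_2)
    then have "(1/2) *\<^sub>R s = e x - (1/2) *\<^sub>R x" by (simp add: scaleR_diff_right)
    then have "(a - (e - (1/2) *\<^sub>R id_blinfun)) x = r s - (1/2) *\<^sub>R s"
      by (simp add: as blinfun.diff_left blinfun.scaleR_left)
    then have "(norm ((a - (e - (1/2) *\<^sub>R id_blinfun)) x))\<^sup>2 =
        inner (r (r s)) s - inner (r s) s + (norm s)\<^sup>2 / 4"
      by (simp add: power2_norm_eq_inner inner_diff_left inner_diff_right inner_commute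
          adjoint_pairD[OF r(2)])
    \<comment> \<open>This is where \<open>r r \<le> r\<close> bounds \<open>r - 1/2\<close> by
      1/2.\<close>
    also have "\<dots> \<le> (norm s)\<^sup>2 / 4" using r(4)[of s] by simp
    also have "(norm s)\<^sup>2 = (norm x)\<^sup>2"
      using adjoint_pairD[OF sae, of x "e x"] adjoint_pairD[OF sae, of x x]
      by (simp add: s_def power2_norm_eq_inner inner_diff_left inner_diff_right inner_commute ee)
    finally show "(norm ((a - (e - (1/2) *\<^sub>R id_blinfun)) x))\<^sup>2 \<le> (1/2)\<^sup>2 * (norm x)\<^sup>2"
      by (simp add: power2_eq_square)
  qed simp
  moreover have "e o\<^sub>L e = e" by (rule blinfun_eqI) (simp add: ee)
  moreover have "clinear e" unfolding e_def by (rule clinear_proj_op[OF K])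
  ultimately show ?thesis using sae comm by blast
qed

text \<open>A binary expansion in place of the spectral theorem. Subtracting \<open>e - 1/2\<close>
  leaves a remainder of norm at most 1/2, whose double is again a contraction commuting with
  \<open>Q\<close>; after \<open>n\<close> rounds the error is at most
  \<open>(1/2) ^ n\<close>.\<close>

lemma selfadjoint_in_closed_span_projections:
  fixes V :: "('a::complex_hilbert \<Rightarrow>\<^sub>L 'a) set"
  assumes V: "subspace V" "closed V"
    and Q: "\<And>S. S \<in> Q \<Longrightarrow> adjoint_pair S S"
    and proj: "\<And>e. clinear e \<Longrightarrow> adjoint_pair e e \<Longrightarrow> e o\<^sub>L e = e \<Longrightarrow>
      (\<And>S. S \<in> Q \<Longrightarrow> S o\<^sub>L e = e o\<^sub>L S) \<Longrightarrow> e \<in> V"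
    and a: "clinear a" "adjoint_pair a a" "\<And>S. S \<in> Q \<Longrightarrow> S o\<^sub>L a = a o\<^sub>L S"
  shows "a \<in> V"
proof -
  have id: "id_blinfun \<in> V"
    by (intro proj clinear_intros selfadjoint_intros) auto
  have approx: "\<exists>v\<in>V. norm (a - v) \<le> (1/2) ^ n"
    if "clinear a" "adjoint_pair a a" "\<And>S. S \<in> Q \<Longrightarrow> S o\<^sub>L a = a o\<^sub>L S" "norm a \<le> 1" for a n
    using that
  proof (induction n arbitrary: a)
    case 0
    then show ?case using subspace_0[OF V(1)] by (intro bexI[of _ 0]) simp_all
  next
    case (Suc n)
    obtain e where e: "clinear e" "adjoint_pair e e" "e o\<^sub>L e = e"
      "\<And>S. adjoint_pair S S \<Longrightarrow> S o\<^sub>L a = a o\<^sub>L S \<Longrightarrow> S o\<^sub>L e = e o\<^sub>L S"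
      "norm (a - (e - (1/2) *\<^sub>R id_blinfun)) \<le> 1/2"
      using spectral_step[OF Suc.prems(1,2,4)] by blast
    let ?h = "e - (1/2) *\<^sub>R id_blinfun"
    have eV: "e \<in> V" using e Q Suc.prems(3) by (intro proj) auto
    then have hV: "?h \<in> V" using id V(1) by (intro subspace_diff subspace_scale)
    have "\<exists>v\<in>V. norm (2 *\<^sub>R (a - ?h) - v) \<le> (1/2) ^ n"
    proof (rule Suc.IH)
      show "clinear (2 *\<^sub>R (a - ?h))" by (intro clinear_intros e Suc.prems)
      show "adjoint_pair (2 *\<^sub>R (a - ?h)) (2 *\<^sub>R (a - ?h))"
        by (intro selfadjoint_intros e Suc.prems)
      show "S o\<^sub>L 2 *\<^sub>R (a - ?h) = 2 *\<^sub>R (a - ?h) o\<^sub>L S" if "S \<in> Q" for S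
        using Suc.prems(3)[OF that] e(4)[OF Q[OF that]] by (simp add: compose_distrib)
      show "norm (2 *\<^sub>R (a - ?h)) \<le> 1" using e(5) by simp
    qed
    then obtain v where v: "v \<in> V" "norm (2 *\<^sub>R (a - ?h) - v) \<le> (1/2) ^ n" by blast
    have "a - (?h + (1/2) *\<^sub>R v) = (1/2) *\<^sub>R (2 *\<^sub>R (a - ?h) - v)"
      by (simp add: scaleR_diff_right)
    then have "norm (a - (?h + (1/2) *\<^sub>R v)) \<le> (1/2) ^ Suc n" using v(2) by simp
    moreover have "?h + (1/2) *\<^sub>R v \<in> V" using hV v(1) V(1) by (intro subspace_add subspace_scale)
    ultimately show ?case by blast
  qed
  have contraction: "a \<in> V"
    if "clinear a" "adjoint_pair a a" "\<And>S. S \<in> Q \<Longrightarrow> S o\<^sub>L a = a o\<^sub>L S" "norm a \<le> 1" for a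
  proof -
    have "\<forall>n. \<exists>v\<in>V. norm (a - v) \<le> (1/2) ^ n" using approx[OF that] by blast
    then obtain v where v: "\<And>n. v n \<in> V" "\<And>n. norm (a - v n) \<le> (1/2) ^ n" by metis
    have "(\<lambda>n. a - v n) \<longlonglongrightarrow> 0"
      by (rule Lim_null_comparison[of _ "\<lambda>n. (1/2) ^ n"]) (use v(2) in \<open>auto intro: LIMSEQ_power_zero\<close>)
    then have "(\<lambda>n. a - (a - v n)) \<longlonglongrightarrow> a - 0" by (intro tendsto_intros)
    then have "v \<longlonglongrightarrow> a" by simp
    then show "a \<in> V" using closed_sequentially[OF V(2)] v(1) by blast
  qed
  show ?thesis
  proof (cases "a = 0")
    case False
    have "(1 / norm a) *\<^sub>R a \<in> V"
      using a False by (intro contraction clinear_intros selfadjoint_intros) (simp_all add: compose_distrib)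
    then have "norm a *\<^sub>R (1 / norm a) *\<^sub>R a \<in> V" using V(1) subspace_scale by blast
    then show ?thesis using False by simp
  qed (use subspace_0[OF V(1)] in simp)
qed

section \<open>The algebra of a commutative subspace lattice\<close>

lemma alg_iff: "T \<in> alg L \<longleftrightarrow> clinear T \<and> (\<forall>M\<in>L. blinfun_apply T ` M \<subseteq> M)"
  by (simp add: alg_def linear_scaleC_iff)

locale csl =
  fixes L :: "'a::complex_hilbert set set"
  assumes csl: "commutative_subspace_lattice L"
begin

lemma member: "M \<in> L \<Longrightarrow> closed M" "M \<in> L \<Longrightarrow> csubspace M"
  using csl by (auto simp: commutative_subspace_lattice_def subspace_lattice_def)

lemma alg_closed:
  "0 \<in> alg L" "id_blinfun \<in> alg L"
  "S \<in> alg L \<Longrightarrow> T \<in> alg L \<Longrightarrow> S + T \<in> alg L"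
  "S \<in> alg L \<Longrightarrow> T \<in> alg L \<Longrightarrow> S - T \<in> alg L"
  "S \<in> alg L \<Longrightarrow> T \<in> alg L \<Longrightarrow> S o\<^sub>L T \<in> alg L"
  "S \<in> alg L \<Longrightarrow> r *\<^sub>R S \<in> alg L"
  "S \<in> alg L \<Longrightarrow> c *\<^sub>C S \<in> alg L"
  using member(2)
  by (auto simp: alg_iff clinear_intros image_subset_iff blinfun.bilinear_simps scaleC_blinfun.rep_eq
      complex_vector.subspace_0 complex_vector.subspace_add complex_vector.subspace_diff
      complex_vector.subspace_scale csubspace_imp_subspace subspace_scale)

lemma closed_alg: "closed (alg L)"
proof -
  have "alg L = {T. clinear T} \<inter> (\<Inter>M\<in>L. \<Inter>x\<in>M. {T. blinfun_apply T x \<in> M})"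
    by (auto simp: alg_iff image_subset_iff)
  moreover have "closed {T. blinfun_apply T x \<in> M}" if "M \<in> L" for M x
    using continuous_closed_vimage[OF member(1)[OF that], of "\<lambda>T. blinfun_apply T x"]
    by (simp add: vimage_def continuous_intros)
  ultimately show ?thesis by (auto intro!: closed_Int closed_clinear closed_INT)
qed

lemma alg_invariant: "T \<in> alg L \<Longrightarrow> M \<in> L \<Longrightarrow> proj_op M o\<^sub>L T o\<^sub>L proj_op M = T o\<^sub>L proj_op M"
  by (simp add: proj_op_invariant_iff member alg_iff)

lemma commutant_subset_alg:
  assumes "clinear T" "\<And>M. M \<in> L \<Longrightarrow> proj_op M o\<^sub>L T = T o\<^sub>L proj_op M"
  shows "T \<in> alg L"
proof -
  have "blinfun_apply T ` M \<subseteq> M" if M: "M \<in> L" for M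
  proof -
    have "proj_op M o\<^sub>L T o\<^sub>L proj_op M = T o\<^sub>L proj_op M"
      using assms(2)[OF M] by (metis compose_assoc proj_op_idem member M)
    then show ?thesis by (simp add: proj_op_invariant_iff member M)
  qed
  then show ?thesis using assms(1) by (simp add: alg_iff)
qed

lemma proj_op_in_alg:
  assumes M: "M \<in> L"
  shows "proj_op M \<in> alg L"
proof (rule commutant_subset_alg)
  show "clinear (proj_op M)" by (rule clinear_proj_op) (use member M in auto)
  fix N assume N: "N \<in> L"
  have "orth_proj N (orth_proj M x) = orth_proj M (orth_proj N x)" for x
    using csl M N unfolding commutative_subspace_lattice_def by (metis comp_apply)
  then show "proj_op N o\<^sub>L proj_op M = proj_op M o\<^sub>L proj_op N"
    by (intro blinfun_eqI) (simp add: proj_op_apply member M N)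
qed

text \<open>The union of the two-sided ideals \<open>P alg L (1 - P)\<close>, \<open>P\<close> ranging over the lattice.\<close>

definition upper :: "('a \<Rightarrow>\<^sub>L 'a) set" where
  "upper = {T \<in> alg L. \<exists>M\<in>L. proj_op M o\<^sub>L T = T \<and> T o\<^sub>L proj_op M = 0}"

text \<open>The orthogonal complement of all ranges of elements of \<open>upper\<close>. These
  ranges are complex subspaces, so the real inner product suffices. The projection
  \<open>core\<close> is the \<open>C\<close> of the opening outline.\<close>

definition coker :: "'a set" where
  "coker = {x. \<forall>T\<in>upper. \<forall>y. inner (T y) x = 0}"

abbreviation core :: "'a \<Rightarrow>\<^sub>L 'a" where
  "core \<equiv> proj_op coker"

lemma upper_ideal:
  assumes A: "A \<in> alg L" and T: "T \<in> upper"
  shows "A o\<^sub>L T \<in> upper"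
proof -
  obtain M where M: "M \<in> L" "proj_op M o\<^sub>L T = T" "T o\<^sub>L proj_op M = 0" and T': "T \<in> alg L"
    using T by (auto simp: upper_def)
  have "proj_op M o\<^sub>L (A o\<^sub>L T) = (proj_op M o\<^sub>L A o\<^sub>L proj_op M) o\<^sub>L T"
    using M(2) by (metis compose_assoc)
  also have "\<dots> = A o\<^sub>L T"
    unfolding alg_invariant[OF A M(1)] using M(2) by (simp add: compose_assoc)
  finally show ?thesis
    using M(1,3) alg_closed(5)[OF A T'] by (auto simp: upper_def compose_assoc)
qed

lemma coker: "closed coker" "csubspace coker"
proof -
  show "closed coker"
    unfolding coker_def Ball_def
    by (intro closed_Collect_all closed_Collect_imp open_Collect_const closed_Collect_eq continuous_intros)
  have "inner (T y) (c *\<^sub>C x) = 0" if "T \<in> upper" "\<And>y. inner (T y) x = 0" for T x y c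
  proof -
    have "inner (T y) (c *\<^sub>C x) = inner (T (cnj c *\<^sub>C y)) x"
      using that(1) by (simp add: upper_def alg_iff clinearD inner_scaleC_left)
    then show ?thesis using that(2) by simp
  qed
  then show "csubspace coker"
    by (auto simp: coker_def complex_vector.subspace_def inner_add_right)
qed

lemma core_facts:
  "adjoint_pair core core" "core o\<^sub>L core = core" "clinear core"
  using proj_op_selfadjoint proj_op_idem clinear_proj_op coker by blast+

text \<open>Dual to \<open>upper_ideal\<close>: moving \<open>S\<close> to the other side replaces
  \<open>T\<close> by \<open>A T\<close>, which is again in \<open>upper\<close>.\<close>

lemma adjoint_coker:
  assumes A: "A \<in> alg L" "adjoint_pair A S"
  shows "blinfun_apply S ` coker \<subseteq> coker"
proof (rule image_subsetI)
  fix x assume x: "x \<in> coker"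
  have "inner (T y) (S x) = 0" if "T \<in> upper" for T y
  proof -
    have "inner (T y) (S x) = inner ((A o\<^sub>L T) y) x" using A(2) by (simp add: adjoint_pair_def)
    also have "\<dots> = 0" using x upper_ideal[OF A(1) that] unfolding coker_def by blast
    finally show ?thesis .
  qed
  then show "S x \<in> coker" by (simp add: coker_def)
qed

lemma core_commute: "M \<in> L \<Longrightarrow> proj_op M o\<^sub>L core = core o\<^sub>L proj_op M"
  by (rule proj_op_commute[OF coker proj_op_selfadjoint adjoint_coker[OF proj_op_in_alg proj_op_selfadjoint]])
    (use member in auto)

lemma core_in_alg: "core \<in> alg L"
  by (rule commutant_subset_alg[OF core_facts(3) core_commute])

lemma adjoint_in_alg_ex:
  assumes "A \<in> alg L"
  obtains S where "clinear S" "adjoint_pair A S"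
  using adjoint_pair_ex[of A] assms that by (auto simp: alg_iff)

lemma core_coinvariant:
  assumes A: "A \<in> alg L"
  shows "core o\<^sub>L A o\<^sub>L core = core o\<^sub>L A"
proof -
  obtain S where S: "clinear S" "adjoint_pair A S" using adjoint_in_alg_ex[OF A] .
  have inv: "core o\<^sub>L S o\<^sub>L core = S o\<^sub>L core"
    using adjoint_coker[OF A S(2)] by (simp add: proj_op_invariant_iff coker)
  note SA = adjoint_pair_sym[OF S(2)]
  have "adjoint_pair (core o\<^sub>L S o\<^sub>L core) (core o\<^sub>L (A o\<^sub>L core))"
    by (intro adjoint_pair_compose core_facts SA)
  moreover have "adjoint_pair (S o\<^sub>L core) (core o\<^sub>L A)"
    by (intro adjoint_pair_compose core_facts SA)
  ultimately show ?thesis unfolding inv using adjoint_pair_unique by (metis compose_assoc)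
qed

text \<open>If \<open>D\<close> kills every range, its adjoint maps into \<open>coker\<close> and is
  fixed by \<open>core\<close> on the left; taking adjoints gives the claim.\<close>

lemma core_separating:
  assumes D: "D \<in> alg L" "\<And>T. T \<in> upper \<Longrightarrow> D o\<^sub>L T = 0"
  shows "D o\<^sub>L core = D"
proof -
  obtain S where S: "clinear S" "adjoint_pair D S" using adjoint_in_alg_ex[OF D(1)] .
  have "S z \<in> coker" for z
  proof -
    have "inner (T y) (S z) = inner ((D o\<^sub>L T) y) z" for T :: "'a \<Rightarrow>\<^sub>L 'a" and y
      using S(2) by (simp add: adjoint_pair_def)
    then have "inner (T y) (S z) = 0" if "T \<in> upper" for T y
      by (simp only: D(2)[OF that] blinfun.zero_left inner_zero_left)
    then show ?thesis by (simp add: coker_def)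
  qed
  then have "core o\<^sub>L S = S" by (intro blinfun_eqI) (simp add: proj_op_eq_iff coker)
  then have "adjoint_pair S (D o\<^sub>L core)"
    using adjoint_pair_compose[OF core_facts(1) adjoint_pair_sym[OF S(2)]] by simp
  then show ?thesis using adjoint_pair_unique adjoint_pair_sym[OF S(2)] by blast
qed

lemma core_upper:
  assumes "T \<in> upper"
  shows "core o\<^sub>L T = 0"
proof (rule blinfun_eq_inner)
  fix y z
  have "inner ((core o\<^sub>L T) y) z = inner (T y) (core z)"
    using core_facts(1) by (simp add: adjoint_pair_def)
  also have "\<dots> = 0" using proj_op_in[OF coker, of z] assms by (simp add: coker_def)
  finally show "inner ((core o\<^sub>L T) y) z = inner (blinfun_apply 0 y) z" by simp
qed

section \<open>The corner cut out by \<open>core\<close>\<close>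

lemma corner_commute:
  assumes X: "X \<in> alg L" "core o\<^sub>L X = X" and M: "M \<in> L"
  shows "proj_op M o\<^sub>L X = X o\<^sub>L proj_op M"
proof -
  let ?P = "proj_op M" and ?T = "(proj_op M o\<^sub>L X) - (X o\<^sub>L proj_op M)"
  have PP: "?P o\<^sub>L ?P = ?P" by (rule proj_op_idem) (use member M in auto)
  have "?P o\<^sub>L ?T = ((?P o\<^sub>L ?P) o\<^sub>L X) - (?P o\<^sub>L X o\<^sub>L ?P)"
    by (simp only: compose_distrib compose_assoc)
  then have 1: "?P o\<^sub>L ?T = ?T" by (simp add: PP alg_invariant[OF X(1) M])
  have "?T o\<^sub>L ?P = (?P o\<^sub>L X o\<^sub>L ?P) - (X o\<^sub>L (?P o\<^sub>L ?P))"
    by (simp only: compose_distrib compose_assoc)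
  then have 2: "?T o\<^sub>L ?P = 0" by (simp add: PP alg_invariant[OF X(1) M])
  \<comment> \<open>By invariance \<open>?T\<close> is \<open>P X (1 - P)\<close>. Hence
    \<open>core\<close> kills it, but \<open>core\<close> also fixes it, since it commutes with
    \<open>P\<close> and fixes \<open>X\<close>.\<close>
  have "?T \<in> upper"
    using 1 2 M X(1) alg_closed proj_op_in_alg[OF M] unfolding upper_def by blast
  then have "core o\<^sub>L ?T = 0" by (rule core_upper)
  then have "(core o\<^sub>L (?P o\<^sub>L X)) - (core o\<^sub>L (X o\<^sub>L ?P)) = 0"
    by (simp only: compose_distrib)
  moreover have "core o\<^sub>L (?P o\<^sub>L X) = ?P o\<^sub>L X"
    using core_commute[OF M] X(2) by (metis compose_assoc)
  moreover have "core o\<^sub>L (X o\<^sub>L ?P) = X o\<^sub>L ?P" using X(2) by (metis compose_assoc)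
  ultimately show ?thesis by simp
qed

lemma adjoint_commute:
  assumes comm: "\<And>M. M \<in> L \<Longrightarrow> proj_op M o\<^sub>L X = X o\<^sub>L proj_op M"
    and S: "adjoint_pair X S" and M: "M \<in> L"
  shows "proj_op M o\<^sub>L S = S o\<^sub>L proj_op M"
proof -
  have P: "adjoint_pair (proj_op M) (proj_op M)" by (rule proj_op_selfadjoint) (use member M in auto)
  show ?thesis
    using adjoint_pair_compose[OF S P] adjoint_pair_compose[OF P S] comm[OF M] adjoint_pair_unique
    by metis
qed

text \<open>Projections commuting with the lattice are idempotents of \<open>alg L\<close>, hence in
  \<open>V\<close>, and so are the self-adjoint operators they approximate. The operators
  \<open>?h\<close> and \<open>?g\<close> are twice the real and imaginary parts of
  \<open>X\<close>.\<close>

lemma commutant_in_closed_subspace: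
  assumes V: "subspace V" "closed V" "\<And>c T. T \<in> V \<Longrightarrow> c *\<^sub>C T \<in> V"
    and idem: "\<And>e. e \<in> alg L \<Longrightarrow> e o\<^sub>L e = e \<Longrightarrow> e \<in> V"
    and X: "clinear X" "\<And>M. M \<in> L \<Longrightarrow> proj_op M o\<^sub>L X = X o\<^sub>L proj_op M"
  shows "X \<in> V"
proof -
  obtain S where S: "clinear S" "adjoint_pair X S" using adjoint_pair_ex[OF X(1)] by blast
  have comm: "proj_op M o\<^sub>L S = S o\<^sub>L proj_op M" if "M \<in> L" for M
    using adjoint_commute[OF X(2) S(2)] that by blast
  have selfadjoint: "h \<in> V"
    if "clinear h" "adjoint_pair h h" "\<And>M. M \<in> L \<Longrightarrow> proj_op M o\<^sub>L h = h o\<^sub>L proj_op M" for h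
  proof (rule selfadjoint_in_closed_span_projections[OF V(1,2), of "proj_op ` L"])
    show "e \<in> V" if "clinear e" "e o\<^sub>L e = e" "\<And>T. T \<in> proj_op ` L \<Longrightarrow> T o\<^sub>L e = e o\<^sub>L T" for e
      using that by (intro idem commutant_subset_alg) auto
  qed (use that member proj_op_selfadjoint in auto)
  let ?h = "X + S" and ?g = "(- \<i>) *\<^sub>C (X - S)"
  have h: "?h \<in> V"
    using X S comm selfadjoint_intros(3)[OF S(2) adjoint_pair_sym[OF S(2)]]
    by (intro selfadjoint clinear_intros) (simp_all add: compose_distrib add.commute)
  have g: "?g \<in> V"
  proof (rule selfadjoint)
    show "clinear ?g" by (intro clinear_intros X S)
    show "adjoint_pair ?g ?g"
      using adjoint_pairD[OF S(2)] adjoint_pairD[OF adjoint_pair_sym[OF S(2)]]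
        clinearD[OF X(1)] clinearD[OF S(1)]
      by (simp add: adjoint_pair_def scaleC_blinfun.rep_eq inner_scaleC_left blinfun.diff_left
          inner_diff_left inner_diff_right complex_vector.scale_right_diff_distrib)
    fix M assume M: "M \<in> L"
    have "clinear (proj_op M)" by (rule clinear_proj_op) (use member M in auto)
    then have 1: "proj_op M o\<^sub>L c *\<^sub>C T = c *\<^sub>C (proj_op M o\<^sub>L T)" for c T
      by (intro blinfun_eqI) (simp add: scaleC_blinfun.rep_eq clinearD)
    have 2: "c *\<^sub>C T o\<^sub>L proj_op M = c *\<^sub>C (T o\<^sub>L proj_op M)" for c T
      by (intro blinfun_eqI) (simp add: scaleC_blinfun.rep_eq)
    show "proj_op M o\<^sub>L ?g = ?g o\<^sub>L proj_op M"
      by (simp only: 1 2 compose_distrib X(2)[OF M] comm[OF M])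
  qed
  have "(1/2) *\<^sub>R (?h + \<i> *\<^sub>C ?g) \<in> V"
    by (rule subspace_scale[OF V(1) subspace_add[OF V(1) h V(3)[OF g]]])
  moreover have "(1/2) *\<^sub>R (?h + \<i> *\<^sub>C ?g) = X"
    by (simp add: scaleC_scaleC scaleC_one flip: scaleR_2)
  ultimately show ?thesis by simp
qed

text \<open>The adjoint \<open>S\<close> of \<open>X\<close> is again in the corner, and
  \<open>X S X = 0\<close> forces first \<open>S X = 0\<close> and then
  \<open>X = 0\<close>.\<close>

lemma corner_semiprime:
  assumes X: "X \<in> alg L" "core o\<^sub>L X = X" "X o\<^sub>L core = X"
    and zero: "\<And>Y. Y \<in> alg L \<Longrightarrow> core o\<^sub>L Y = Y \<Longrightarrow> Y o\<^sub>L core = Y \<Longrightarrow> X o\<^sub>L Y o\<^sub>L X = 0"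
  shows "X = 0"
proof -
  obtain S where S: "clinear S" "adjoint_pair X S" using adjoint_in_alg_ex[OF X(1)] .
  have "S \<in> alg L"
    using adjoint_commute[OF corner_commute[OF X(1,2)] S(2)] by (rule commutant_subset_alg[OF S(1)])
  moreover have "core o\<^sub>L S = S" "S o\<^sub>L core = S"
    using adjoint_pair_compose[OF S(2) core_facts(1), unfolded X(3)]
      adjoint_pair_compose[OF core_facts(1) S(2), unfolded X(2)]
    by (simp_all only: adjoint_pair_unique[OF S(2), symmetric])
  ultimately have XSX: "X o\<^sub>L S o\<^sub>L X = 0" by (rule zero)
  have SX: "S (X y) = 0" for y
  proof -
    have "X (S (X y)) = 0" using arg_cong[OF XSX, of "\<lambda>T. blinfun_apply T y"] by simp
    then have "inner (S (X y)) (S (X y)) = 0" by (simp flip: adjoint_pairD[OF S(2)])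
    then show ?thesis by simp
  qed
  have "inner (X y) (X y) = 0" for y by (simp add: adjoint_pairD[OF S(2)] SX)
  then show ?thesis by (intro blinfun_eqI) simp
qed

end

text \<open>
  Type class instances for \<^typ>\<open>'a \<Rightarrow>\<^sub>L 'b\<close> cannot require \<open>'a = 'b\<close>, so the ring
  structure given by composition needs a type of its own.
\<close>

typedef (overloaded) 'a endo = "UNIV :: ('a::real_normed_vector \<Rightarrow>\<^sub>L 'a) set"
  morphisms of_endo to_endo ..

setup_lifting type_definition_endo

instantiation endo :: (real_normed_vector) real_algebra
begin
lift_definition zero_endo :: "'a endo" is 0 .
lift_definition plus_endo :: "'a endo \<Rightarrow> 'a endo \<Rightarrow> 'a endo" is "(+)" .
lift_definition minus_endo :: "'a endo \<Rightarrow> 'a endo \<Rightarrow> 'a endo" is "(-)" .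
lift_definition uminus_endo :: "'a endo \<Rightarrow> 'a endo" is uminus .
lift_definition times_endo :: "'a endo \<Rightarrow> 'a endo \<Rightarrow> 'a endo" is "(o\<^sub>L)" .
lift_definition scaleR_endo :: "real \<Rightarrow> 'a endo \<Rightarrow> 'a endo" is scaleR .
instance
  by standard (transfer; simp add: compose_distrib compose_assoc scaleR_add_left scaleR_add_right)+
end

lemmas endo_rep = zero_endo.rep_eq plus_endo.rep_eq minus_endo.rep_eq times_endo.rep_eq
  scaleR_endo.rep_eq to_endo_inverse[OF UNIV_I]

lemma endo_eq_iff: "x = y \<longleftrightarrow> of_endo x = of_endo y"
  by (simp add: of_endo_inject)

theorem theorem5p5:
  fixes m n :: int
    and L :: "'a::complex_hilbert set set"
    and \<delta> :: "('a \<Rightarrow>\<^sub>L 'a) \<Rightarrow> ('a \<Rightarrow>\<^sub>L 'a)"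
  assumes "m \<noteq> 0" and "n \<noteq> 0" and "m + n \<noteq> 0"
    and "separable_space (euclidean :: 'a topology)"
    and "commutative_subspace_lattice L"
    and "continuous_on (alg L) \<delta>"
    and "derivable_at_0 m n (alg L) \<delta>"
    and "\<delta> id_blinfun = 0"
  shows "derivation_on (alg L) \<delta>"
proof -
  interpret csl L by unfold_locales (rule assms(5))
  have lin: "linear_map_on (alg L) \<delta>" using assms(7) by (simp add: derivable_at_0_def)
  have \<delta>_closed: "\<delta> A \<in> alg L" if "A \<in> alg L" for A
    using lin that by (auto simp: linear_map_on_def)
  have \<delta>_add: "\<delta> (A + B) = \<delta> A + \<delta> B" if "A \<in> alg L" "B \<in> alg L" for A B
    using lin that by (auto simp: linear_map_on_def)
  have \<delta>_scaleC: "\<delta> (c *\<^sub>C A) = c *\<^sub>C \<delta> A" if "A \<in> alg L" for c A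
    using lin that by (auto simp: linear_map_on_def)
  have of_int: "complex_of_int k *\<^sub>C T = real_of_int k *\<^sub>R T" for k and T :: "'a \<Rightarrow>\<^sub>L 'a"
    by (simp add: scaleR_scaleC)
  have \<delta>_0: "\<delta> 0 = 0" using \<delta>_add[OF alg_closed(1) alg_closed(1)] by simp
  define f where "f x = to_endo (\<delta> (of_endo x))" for x
  define A where "A = {x. of_endo x \<in> alg L}"
  interpret additive_map_on A f
    by unfold_locales
      (simp_all add: A_def f_def endo_rep alg_closed \<delta>_closed \<delta>_add endo_eq_iff)
  \<comment> \<open>The closed subspace of the outline, phrased with \<open>\<delta>\<close> for the
    topological arguments; \<open>V_iff\<close> translates it into
    \<open>jordan_pair\<close>.\<close>
  define V where "V = {T \<in> alg L. \<forall>Y\<in>alg L.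
    \<delta> ((Y o\<^sub>L T) + (T o\<^sub>L Y)) = (\<delta> Y o\<^sub>L T) + (Y o\<^sub>L \<delta> T) + (\<delta> T o\<^sub>L Y) + (T o\<^sub>L \<delta> Y)}"
  have ball_alg: "(\<forall>Y\<in>alg L. Q Y) \<longleftrightarrow> (\<forall>x\<in>A. Q (of_endo x))" for Q
    unfolding A_def by (metis mem_Collect_eq to_endo_inverse UNIV_I)
  have V_iff: "T \<in> V \<longleftrightarrow> T \<in> alg L \<and> (\<forall>x\<in>A. jordan_pair f x (to_endo T))" for T
    unfolding V_def mem_Collect_eq ball_alg
    by (simp add: jordan_pair_def f_def endo_eq_iff endo_rep)
  have compose_scaleC: "Y o\<^sub>L c *\<^sub>C T = c *\<^sub>C (Y o\<^sub>L T)" "c *\<^sub>C T o\<^sub>L Y = c *\<^sub>C (T o\<^sub>L Y)"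
    if "Y \<in> alg L" for Y T c
    using that by (auto intro!: blinfun_eqI simp: scaleC_blinfun.rep_eq alg_iff clinearD)
  have V_scaleC: "c *\<^sub>C T \<in> V" if T: "T \<in> V" for c T
  proof -
    have T': "T \<in> alg L" using T by (simp add: V_def)
    have "\<delta> ((Y o\<^sub>L c *\<^sub>C T) + (c *\<^sub>C T o\<^sub>L Y)) = (\<delta> Y o\<^sub>L c *\<^sub>C T) + (Y o\<^sub>L \<delta> (c *\<^sub>C T)) +
        (\<delta> (c *\<^sub>C T) o\<^sub>L Y) + (c *\<^sub>C T o\<^sub>L \<delta> Y)" if Y: "Y \<in> alg L" for Y
    proof -
      have "\<delta> ((Y o\<^sub>L c *\<^sub>C T) + (c *\<^sub>C T o\<^sub>L Y)) = c *\<^sub>C \<delta> ((Y o\<^sub>L T) + (T o\<^sub>L Y))"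
        using Y T' alg_closed \<delta>_scaleC by (simp add: compose_scaleC flip: scaleC_add_right)
      also have "\<delta> ((Y o\<^sub>L T) + (T o\<^sub>L Y)) = (\<delta> Y o\<^sub>L T) + (Y o\<^sub>L \<delta> T) + (\<delta> T o\<^sub>L Y) + (T o\<^sub>L \<delta> Y)"
        using T Y by (simp add: V_def)
      finally show ?thesis
        using Y T' by (simp add: compose_scaleC \<delta>_closed \<delta>_scaleC scaleC_add_right)
    qed
    then show ?thesis using T' alg_closed by (simp add: V_def)
  qed
  have V_add: "S + T \<in> V" if "S \<in> V" "T \<in> V" for S T
  proof -
    have mem: "S \<in> alg L" "T \<in> alg L" using that by (simp_all add: V_def)
    have "\<delta> ((Y o\<^sub>L (S + T)) + ((S + T) o\<^sub>L Y)) = (\<delta> Y o\<^sub>L (S + T)) + (Y o\<^sub>L \<delta> (S + T)) +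
        (\<delta> (S + T) o\<^sub>L Y) + ((S + T) o\<^sub>L \<delta> Y)" if Y: "Y \<in> alg L" for Y
    proof -
      have "(Y o\<^sub>L (S + T)) + ((S + T) o\<^sub>L Y) =
          ((Y o\<^sub>L S) + (S o\<^sub>L Y)) + ((Y o\<^sub>L T) + (T o\<^sub>L Y))"
        by (simp add: compose_distrib)
      then have "\<delta> ((Y o\<^sub>L (S + T)) + ((S + T) o\<^sub>L Y)) =
          \<delta> ((Y o\<^sub>L S) + (S o\<^sub>L Y)) + \<delta> ((Y o\<^sub>L T) + (T o\<^sub>L Y))"
        by (simp only: \<delta>_add alg_closed mem Y)
      also have "\<delta> ((Y o\<^sub>L S) + (S o\<^sub>L Y)) =
          (\<delta> Y o\<^sub>L S) + (Y o\<^sub>L \<delta> S) + (\<delta> S o\<^sub>L Y) + (S o\<^sub>L \<delta> Y)"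
        using \<open>S \<in> V\<close> Y by (simp add: V_def)
      also have "\<delta> ((Y o\<^sub>L T) + (T o\<^sub>L Y)) =
          (\<delta> Y o\<^sub>L T) + (Y o\<^sub>L \<delta> T) + (\<delta> T o\<^sub>L Y) + (T o\<^sub>L \<delta> Y)"
        using \<open>T \<in> V\<close> Y by (simp add: V_def)
      finally show ?thesis using mem by (simp add: \<delta>_add compose_distrib)
    qed
    then show ?thesis using mem alg_closed by (simp add: V_def)
  qed
  have V_subspace: "subspace V"
    unfolding subspace_def scaleR_scaleC
    using V_add V_scaleC alg_closed(1) by (auto simp: V_def \<delta>_0)
  have V_diff: "S - T \<in> V" if "S \<in> V" "T \<in> V" for S T
    using that V_subspace subspace_diff by blast
  \<comment> \<open>Norm continuity of \<open>\<delta>\<close> lets the Jordan identity pass to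
    limits.\<close>
  have V_closed: "closed V"
    unfolding closed_sequential_limits
  proof (intro allI impI, elim conjE)
    fix t l assume t: "\<forall>k. t k \<in> V" and lim: "t \<longlonglongrightarrow> l"
    have tA: "t k \<in> alg L" for k using t by (simp add: V_def)
    then have l: "l \<in> alg L" using closed_sequentially[OF closed_alg _ lim] by blast
    have \<delta>_lim: "(\<lambda>k. \<delta> (s k)) \<longlonglongrightarrow> \<delta> s'" if "\<And>k. s k \<in> alg L" "s' \<in> alg L" "s \<longlonglongrightarrow> s'" for s s'
      using that assms(6) by (auto simp: continuous_on_sequentially o_def)
    note compose_lim = bounded_bilinear.tendsto[OF bounded_bilinear_blinfun_compose]
    have "\<delta> ((Y o\<^sub>L l) + (l o\<^sub>L Y)) = (\<delta> Y o\<^sub>L l) + (Y o\<^sub>L \<delta> l) + (\<delta> l o\<^sub>L Y) + (l o\<^sub>L \<delta> Y)"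
      if Y: "Y \<in> alg L" for Y
    proof (rule LIMSEQ_unique)
      show "(\<lambda>k. \<delta> ((Y o\<^sub>L t k) + (t k o\<^sub>L Y))) \<longlonglongrightarrow> \<delta> ((Y o\<^sub>L l) + (l o\<^sub>L Y))"
        by (intro \<delta>_lim alg_closed Y tA l tendsto_intros compose_lim lim)
      have eq: "\<delta> ((Y o\<^sub>L t k) + (t k o\<^sub>L Y)) =
          (\<delta> Y o\<^sub>L t k) + (Y o\<^sub>L \<delta> (t k)) + (\<delta> (t k) o\<^sub>L Y) + (t k o\<^sub>L \<delta> Y)" for k
        using t Y by (simp add: V_def)
      show "(\<lambda>k. \<delta> ((Y o\<^sub>L t k) + (t k o\<^sub>L Y))) \<longlonglongrightarrow>
          (\<delta> Y o\<^sub>L l) + (Y o\<^sub>L \<delta> l) + (\<delta> l o\<^sub>L Y) + (l o\<^sub>L \<delta> Y)"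
        unfolding eq by (intro \<delta>_lim tA l tendsto_intros compose_lim lim)
    qed
    then show "l \<in> V" using l by (simp add: V_def)
  qed
  \<comment> \<open>The term with \<open>\<delta> (A o\<^sub>L B)\<close> is gone because
    \<open>\<delta> 0 = 0\<close>.\<close>
  have zero_product: "real_of_int n *\<^sub>R f (y * x) =
      real_of_int m *\<^sub>R (f x * y + x * f y) + real_of_int n *\<^sub>R (f y * x + y * f x)"
    if "x \<in> A" "y \<in> A" "x * y = 0" for x y
    using assms(7) that unfolding derivable_at_0_def
    by (simp add: A_def f_def endo_eq_iff endo_rep of_int \<delta>_0 scaleR_add_right add.assoc)
  have V_idem: "e \<in> V" if e: "e \<in> alg L" "e o\<^sub>L e = e" for e
    unfolding V_iff
  proof (intro conjI ballI e(1))
    fix x assume "x \<in> A"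
    then show "jordan_pair f x (to_endo e)"
      using assms(3,8) e
      by (intro jordan_pair_idempotent[of "real_of_int m" "real_of_int n" "to_endo id_blinfun"] zero_product)
        (auto simp: A_def f_def endo_eq_iff endo_rep alg_closed simp flip: of_int_add)
  qed
  have image: "x \<in> to_endo ` V" if "of_endo x \<in> V" for x
    using imageI[OF that, of to_endo] by (simp add: of_endo_inverse)
  have leibniz: "leibniz_pair f a b" if "a \<in> A" "b \<in> A" for a b
  proof (rule leibniz_of_jordan[where u = "to_endo id_blinfun" and V = "to_endo ` V" and
        P = "(\<lambda>M. to_endo (proj_op M)) ` L" and c = "to_endo core"])
    show "d * to_endo core = d" if "d \<in> A" and
      d: "\<And>p t. p \<in> (\<lambda>M. to_endo (proj_op M)) ` L \<Longrightarrow> t \<in> A \<Longrightarrow> p * t = t \<Longrightarrow> t * p = 0 \<Longrightarrow> d * t = 0"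
      for d
    proof -
      have "of_endo d o\<^sub>L T = 0" if "T \<in> upper" for T
        using that d[of _ "to_endo T"] unfolding upper_def
        by (force simp: A_def endo_eq_iff endo_rep)
      then show ?thesis using core_separating[of "of_endo d"] \<open>d \<in> A\<close>
        by (simp add: A_def endo_eq_iff endo_rep)
    qed
    show "x \<in> to_endo ` V" if "x \<in> A" "to_endo core * x = x" "x * to_endo core = x" for x
    proof -
      have x: "of_endo x \<in> alg L" "core o\<^sub>L of_endo x = of_endo x"
        using that by (simp_all add: A_def endo_eq_iff endo_rep)
      \<comment> \<open>The corner commutes with the lattice, so approximation by projections places
        it in \<open>V\<close>.\<close>
      have "of_endo x \<in> V"
        by (rule commutant_in_closed_subspace[OF V_subspace V_closed V_scaleC V_idem _ corner_commute[OF x]])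
          (use x(1) in \<open>simp_all add: alg_iff\<close>)
      then show ?thesis by (rule image)
    qed
    show "x = 0" if "x \<in> A" "to_endo core * x = x" "x * to_endo core = x" and
      zero: "\<And>y. y \<in> A \<Longrightarrow> to_endo core * y = y \<Longrightarrow> y * to_endo core = y \<Longrightarrow> x * y * x = 0" for x
    proof -
      have "of_endo x = 0"
      proof (rule corner_semiprime)
        fix Y assume "Y \<in> alg L" "core o\<^sub>L Y = Y" "Y o\<^sub>L core = Y"
        then show "of_endo x o\<^sub>L Y o\<^sub>L of_endo x = 0"
          using zero[of "to_endo Y"] by (simp add: A_def endo_eq_iff endo_rep)
      qed (use that in \<open>simp_all add: A_def endo_eq_iff endo_rep\<close>)
      then show ?thesis by (simp add: endo_eq_iff endo_rep)
    qed
    show "p \<in> to_endo ` V" if "p \<in> A" "p * p = p" for p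
    proof -
      have "of_endo p \<in> V" using that by (intro V_idem) (simp_all add: A_def endo_eq_iff endo_rep)
      then show ?thesis by (rule image)
    qed
    show "x - y \<in> to_endo ` V" if "x \<in> to_endo ` V" "y \<in> to_endo ` V" for x y
    proof -
      have "of_endo (x - y) \<in> V" using that by (auto simp: endo_rep intro: V_diff)
      then show ?thesis by (rule image)
    qed
  qed (use that V_iff alg_closed core_in_alg core_facts core_coinvariant alg_invariant proj_op_in_alg
      proj_op_idem[OF member] in \<open>auto simp: A_def endo_eq_iff endo_rep\<close>)
  have "\<delta> (S o\<^sub>L T) = (\<delta> S o\<^sub>L T) + (S o\<^sub>L \<delta> T)" if "S \<in> alg L" "T \<in> alg L" for S T
    using leibniz[of "to_endo S" "to_endo T"] that
    by (simp add: A_def f_def leibniz_pair_def endo_eq_iff endo_rep)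
  then show ?thesis using lin by (simp add: derivation_on_def)
qed

end
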